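(* Let $n\ge1$. The expression $$m_{A,B,C}=-\tfrac12 (A^{tr})^{-1}(B^{tr})^{-1}(C^{tr})^{-1}\Big(C^{tr}\big(B^{tr}\mathcal{B}(A)_{low}B\big)^{diag}+\big(C^{tr}\mathcal{B}(AB)_{low}C\big)^{diag}-\mathrm{iso}(A)\big(C^{tr}\mathcal{B}(B)_{low}C\big)^{diag}-\big(C^{tr}B^{tr}\mathcal{B}(A)_{low}BC\big)^{diag}\Big)$$ defines a 3-cocycle on the group $\mathrm{O}^{\pm}(n,n,\mathbb{Z})$ with values in $\mathbb{Z}^{2n}$, with respect to the action $(A,m)\mapsto IAIm$, and it represents the k-invariant of $\mathrm{AUT}(\mathbb{TD}_n)$ in $\mathrm{H}^3(\mathrm{O}^{\pm}(n,n,\mathbb{Z}),\mathbb{Z}^{2n})$.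
   Context: **Matrices.** $J=\begin{pmatrix}0&0\\ E_n&0\end{pmatrix}$, $I=\begin{pmatrix}0&E_n\\ E_n&0\end{pmatrix}$. $\mathrm{O}^{\pm}(n,n,\mathbb{Z})=\{A\in\mathrm{GL}(2n,\mathbb{Z}):A^{tr}IA=\pm I\}$, and $\mathrm{iso}(A)\in\{\pm1\}$ is defined by $A^{tr}IA=\mathrm{iso}(A)I$. For $A\in\mathrm{O}^{\pm}(n,n,\mathbb{Z})$, $\mathcal{B}(A):=\mathrm{iso}(A)J-A^{tr}JA$, which is skew-symmetric. For a skew-symmetric $B$, $B_{low}$ is the lower triangular matrix with zero diagonal such that $B=B_{low}-B_{low}^{tr}$. $(\cdot)^{diag}:\mathbb{Z}^{2n\times2n}\to\mathbb{Z}^{2n}$ extracts the diagonal of a matrix as a vector. **The 2-group.** $\mathbb{TD}_n$ is the crossed module of Lie groups $(\mathbb{R}^{2n},\mathbb{Z}^{2n}\times\mathrm{U}(1),t,\alpha)$ with $\mathrm{U}(1)=\mathbb{R}/\mathbb{Z}$, $t(m,s)=m$, $\alpha(a,(m,s))=(m,s-a^{tr}Jm)$, regarded as a strict Lie 2-group. That is, it is the Lie groupoid with objects $\mathbb{R}^{2n}$, morphisms $(h,a):a\to t(h)+a$ in $(\mathbb{Z}^{2n}\times\mathrm{U}(1))\ltimes_\alpha\mathbb{R}^{2n}$, and multiplication given by the group structures. $\mathrm{AUT}(\mathbb{TD}_n)$ is its automorphism 2-group: objects are invertible smooth anafunctors $F:\mathbb{TD}_n\to\mathbb{TD}_n$ equipped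 with coherent multiplicator transformations $F\circ m\Rightarrow m\circ(F\times F)$; morphisms are compatible anafunctor transformations; the product is composition. It is equivalent to the strict 2-group $\mathbb{A}_n$ whose objects are pairs $(A,\eta)$, $A\in\mathrm{O}^{\pm}(n,n,\mathbb{Z})$, $\eta:\mathbb{R}^{2n}\times\mathbb{R}^{2n}\to\mathrm{U}(1)$ a smooth group 2-cocycle (trivial coefficients), vanishing on $\mathbb{Z}^{2n}\times\mathbb{Z}^{2n}$, with $\eta(m,a)+\mathrm{iso}(A)a^{tr}Jm=\eta(a,m)+(Aa)^{tr}J(Am)$ for $m\in\mathbb{Z}^{2n}$, $a\in\mathbb{R}^{2n}$, with product $(A_1,\eta_1)(A_2,\eta_2)=(A_1A_2,\eta_1\circ(A_2\times A_2)+\mathrm{iso}(A_1)\eta_2)$. Its morphisms $(A,\eta)\to(A,\eta')$ are smooth $\beta:\mathbb{R}^{2n}\to\mathrm{U}(1)$ with $\beta|_{\mathbb{Z}^{2n}}=0$ and $\beta(a_1)+\beta(a_2)+\eta(a_1,a_2)=\eta'(a_1,a_2)+\beta(a_1+a_2)$, composed by addition, with product $(\beta_1\cdot\beta_2)(a)=\beta_1(A_2a)+\mathrm{iso}(A_1)\beta_2(a)$. The identifications used are $\pi_0\cong\mathrm{O}^{\pm}(n,n,\mathbb{Z})$, $(A,\eta)\mapsto A$, and $\mathbb{Z}^{2n}\cong\pi_1=\mathrm{Aut}(E_{2n},0)=\mathrm{Hom}^\infty(\mathbb{T}^{2n},\mathrm{U}(1))$, $m\mapsto(a\mapsto m\cdot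 a)$. **k-invariant.** For a strict 2-group $\Gamma$ with $\pi_0\Gamma=G$, $\pi_1\Gamma=\mathrm{Aut}(1)=A$: choose a section $S:G\to\Gamma_0$ with $S(1)=1$ and isomorphisms $\beta_{g,h}:S(g)S(h)\to S(gh)$ with $\beta_{1,g},\beta_{g,1}$ identities. The k-invariant is the class in $\mathrm{H}^3(G,A)$ of the cocycle $\xi$ determined by $(\xi_{g,h,k}\cdot\mathrm{id}_{S(ghk)})\circ\beta_{gh,k}\circ(\beta_{g,h}\cdot\mathrm{id}_{S(k)})=\beta_{g,hk}\circ(\mathrm{id}_{S(g)}\cdot\beta_{h,k})$. It is invariant under equivalence, hence defined for $\mathrm{AUT}(\mathbb{TD}_n)$ via $\mathbb{A}_n$. *)

theory Defs
  imports "HOL-Algebra.Group" "HOL-Analysis.Analysis"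
begin

section \<open>The circle group and smooth maps\<close>

text \<open>The group U(1) is the additive group of real numbers modulo integers.\<close>

quotient_type circle = real / "\<lambda>x y :: real. x - y \<in> \<int>"
proof (rule equivpI)
  show "reflp (\<lambda>x y :: real. x - y \<in> \<int>)"
    by (simp add: reflp_def)
  show "symp (\<lambda>x y :: real. x - y \<in> \<int>)"
    by (metis (no_types, lifting) Ints_minus minus_diff_eq sympI)
  show "transp (\<lambda>x y :: real. x - y \<in> \<int>)"
  proof (rule transpI)
    fix x y z :: real
    assume "x - y \<in> \<int>" "y - z \<in> \<int>"
    then have "(x - y) + (y - z) \<in> \<int>" by (rule Ints_add)
    then show "x - z \<in> \<int>" by simp
  qed
qed

instantiation circle :: ab_group_add
begin

lift_definition zero_circle :: circle is "0 :: real" .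

lift_definition plus_circle :: "circle \<Rightarrow> circle \<Rightarrow> circle" is "(+) :: real \<Rightarrow> real \<Rightarrow> real"
proof -
  fix x x' y y' :: real
  assume "x - x' \<in> \<int>" "y - y' \<in> \<int>"
  then have "(x - x') + (y - y') \<in> \<int>" by (rule Ints_add)
  then show "(x + y) - (x' + y') \<in> \<int>" by (simp add: algebra_simps)
qed

lift_definition uminus_circle :: "circle \<Rightarrow> circle" is "uminus :: real \<Rightarrow> real"
  by (metis Ints_minus minus_diff_eq minus_diff_minus)

lift_definition minus_circle :: "circle \<Rightarrow> circle \<Rightarrow> circle" is "(-) :: real \<Rightarrow> real \<Rightarrow> real"
proof -
  fix x x' y y' :: real
  assume "x - x' \<in> \<int>" "y - y' \<in> \<int>"
  then have "(x - x') - (y - y') \<in> \<int>" by (rule Ints_diff)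
  then show "(x - y) - (x' - y') \<in> \<int>" by (simp add: algebra_simps)
qed

instance
  by standard (transfer; simp add: algebra_simps)+

end

lift_definition of_real_circle :: "real \<Rightarrow> circle" is "\<lambda>x. x" .

lift_definition zscale :: "int \<Rightarrow> circle \<Rightarrow> circle" is "\<lambda>k x. real_of_int k * x"
  by (metis Ints_mult Ints_of_int right_diff_distrib)

fun Ck_on :: "nat \<Rightarrow> 'a::euclidean_space set \<Rightarrow> ('a \<Rightarrow> real) \<Rightarrow> bool" where
  "Ck_on 0 S f \<longleftrightarrow> continuous_on S f"
| "Ck_on (Suc k) S f \<longleftrightarrow>
     (\<forall>x\<in>S. f differentiable (at x)) \<and>
     (\<forall>v. Ck_on k S (\<lambda>x. frechet_derivative f (at x) v))"

definition smooth_on :: "'a::euclidean_space set \<Rightarrow> ('a \<Rightarrow> real) \<Rightarrow> bool" where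
  "smooth_on S f \<longleftrightarrow> (\<forall>k. Ck_on k S f)"

text \<open>
  The projection from the real line to the circle is a surjective local diffeomorphism, so a map
  into the circle is smooth if and only if it locally lifts to smooth real-valued functions.
\<close>

definition smooth_circle :: "('a::euclidean_space \<Rightarrow> circle) \<Rightarrow> bool" where
  "smooth_circle \<phi> \<longleftrightarrow>
     (\<forall>x. \<exists>U f. open U \<and> x \<in> U \<and> smooth_on U f \<and> (\<forall>y\<in>U. \<phi> y = of_real_circle (f y)))"


section \<open>Group cohomology in degree three\<close>

text \<open>
  Inhomogeneous cochains on a group \<open>G\<close> with values in the abelian group \<open>'a\<close>, on which \<open>G\<close> acts
  from the left by \<open>act\<close>. Values outside the carrier of \<open>G\<close> are irrelevant: two cochains that agree
  on the carrier are cohomologous.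
\<close>

definition cocycles3 ::
  "'g monoid \<Rightarrow> ('g \<Rightarrow> 'a \<Rightarrow> 'a) \<Rightarrow> ('g \<Rightarrow> 'g \<Rightarrow> 'g \<Rightarrow> 'a::ab_group_add) set" where
  "cocycles3 G act = {c. \<forall>g\<in>carrier G. \<forall>h\<in>carrier G. \<forall>k\<in>carrier G. \<forall>l\<in>carrier G.
     act g (c h k l) - c (g \<otimes>\<^bsub>G\<^esub> h) k l + c g (h \<otimes>\<^bsub>G\<^esub> k) l - c g h (k \<otimes>\<^bsub>G\<^esub> l) + c g h k = 0}"

definition coboundaries3 ::
  "'g monoid \<Rightarrow> ('g \<Rightarrow> 'a \<Rightarrow> 'a) \<Rightarrow> ('g \<Rightarrow> 'g \<Rightarrow> 'g \<Rightarrow> 'a::ab_group_add) set" where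
  "coboundaries3 G act = {c. \<exists>b. \<forall>g\<in>carrier G. \<forall>h\<in>carrier G. \<forall>k\<in>carrier G.
     c g h k = act g (b h k) - b (g \<otimes>\<^bsub>G\<^esub> h) k + b g (h \<otimes>\<^bsub>G\<^esub> k) - b g h}"

definition cohomologous3 ::
  "'g monoid \<Rightarrow> ('g \<Rightarrow> 'a \<Rightarrow> 'a) \<Rightarrow>
   (('g \<Rightarrow> 'g \<Rightarrow> 'g \<Rightarrow> 'a) \<times> ('g \<Rightarrow> 'g \<Rightarrow> 'g \<Rightarrow> 'a::ab_group_add)) set" where
  "cohomologous3 G act = {(c, c'). c \<in> cocycles3 G act \<and> c' \<in> cocycles3 G act \<and>
     (\<lambda>g h k. c g h k - c' g h k) \<in> coboundaries3 G act}"

text \<open>The class of a cocycle in the third cohomology group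
  \<open>cocycles3 G act // cohomologous3 G act\<close>.\<close>

definition H3_class ::
  "'g monoid \<Rightarrow> ('g \<Rightarrow> 'a \<Rightarrow> 'a) \<Rightarrow> ('g \<Rightarrow> 'g \<Rightarrow> 'g \<Rightarrow> 'a::ab_group_add) \<Rightarrow>
   ('g \<Rightarrow> 'g \<Rightarrow> 'g \<Rightarrow> 'a) set" where
  "H3_class G act c = cohomologous3 G act `` {c}"


section \<open>Strict 2-groups and their k-invariant\<close>

text \<open>
  A strict 2-group is a category internal to groups; its underlying category is automatically a
  groupoid. In \<open>vcomp \<Gamma> f' f\<close> the morphism \<open>f\<close> comes first.
\<close>

record ('o, 'm) two_group_data =
  Obj :: "'o monoid"
  Mor :: "'m monoid"
  src :: "'m \<Rightarrow> 'o"
  tgt :: "'m \<Rightarrow> 'o"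
  idm :: "'o \<Rightarrow> 'm"
  vcomp :: "'m \<Rightarrow> 'm \<Rightarrow> 'm"

locale strict_two_group =
  fixes \<Gamma> :: "('o, 'm) two_group_data"
  assumes Obj_group: "group (Obj \<Gamma>)"
    and Mor_group: "group (Mor \<Gamma>)"
    and src_hom: "src \<Gamma> \<in> hom (Mor \<Gamma>) (Obj \<Gamma>)"
    and tgt_hom: "tgt \<Gamma> \<in> hom (Mor \<Gamma>) (Obj \<Gamma>)"
    and idm_hom: "idm \<Gamma> \<in> hom (Obj \<Gamma>) (Mor \<Gamma>)"
    and src_idm: "x \<in> carrier (Obj \<Gamma>) \<Longrightarrow> src \<Gamma> (idm \<Gamma> x) = x"
    and tgt_idm: "x \<in> carrier (Obj \<Gamma>) \<Longrightarrow> tgt \<Gamma> (idm \<Gamma> x) = x"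
    and vcomp_closed: "\<lbrakk>f \<in> carrier (Mor \<Gamma>); f' \<in> carrier (Mor \<Gamma>); tgt \<Gamma> f = src \<Gamma> f'\<rbrakk>
          \<Longrightarrow> vcomp \<Gamma> f' f \<in> carrier (Mor \<Gamma>)"
    and src_vcomp: "\<lbrakk>f \<in> carrier (Mor \<Gamma>); f' \<in> carrier (Mor \<Gamma>); tgt \<Gamma> f = src \<Gamma> f'\<rbrakk>
          \<Longrightarrow> src \<Gamma> (vcomp \<Gamma> f' f) = src \<Gamma> f"
    and tgt_vcomp: "\<lbrakk>f \<in> carrier (Mor \<Gamma>); f' \<in> carrier (Mor \<Gamma>); tgt \<Gamma> f = src \<Gamma> f'\<rbrakk>
          \<Longrightarrow> tgt \<Gamma> (vcomp \<Gamma> f' f) = tgt \<Gamma> f'"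
    and vcomp_assoc: "\<lbrakk>f \<in> carrier (Mor \<Gamma>); f' \<in> carrier (Mor \<Gamma>); f'' \<in> carrier (Mor \<Gamma>);
          tgt \<Gamma> f = src \<Gamma> f'; tgt \<Gamma> f' = src \<Gamma> f''\<rbrakk>
          \<Longrightarrow> vcomp \<Gamma> f'' (vcomp \<Gamma> f' f) = vcomp \<Gamma> (vcomp \<Gamma> f'' f') f"
    and vcomp_idm_src: "f \<in> carrier (Mor \<Gamma>) \<Longrightarrow> vcomp \<Gamma> f (idm \<Gamma> (src \<Gamma> f)) = f"
    and vcomp_idm_tgt: "f \<in> carrier (Mor \<Gamma>) \<Longrightarrow> vcomp \<Gamma> (idm \<Gamma> (tgt \<Gamma> f)) f = f"
    and interchange: "\<lbrakk>f1 \<in> carrier (Mor \<Gamma>); f1' \<in> carrier (Mor \<Gamma>); tgt \<Gamma> f1 = src \<Gamma> f1';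
          f2 \<in> carrier (Mor \<Gamma>); f2' \<in> carrier (Mor \<Gamma>); tgt \<Gamma> f2 = src \<Gamma> f2'\<rbrakk>
          \<Longrightarrow> vcomp \<Gamma> f1' f1 \<otimes>\<^bsub>Mor \<Gamma>\<^esub> vcomp \<Gamma> f2' f2
            = vcomp \<Gamma> (f1' \<otimes>\<^bsub>Mor \<Gamma>\<^esub> f2') (f1 \<otimes>\<^bsub>Mor \<Gamma>\<^esub> f2)"

text \<open>
  A strict 2-group together with identifications of its invariants: \<open>p\<close> induces an isomorphism from
  the group of isomorphism classes of objects to \<open>G\<close>, and \<open>i\<close> is an isomorphism from the abelian
  group \<open>'a\<close> to the automorphism group of the unit object, under which the action \<open>act\<close> corresponds
  to conjugation with identity morphisms.
\<close>

locale identified_two_group = strict_two_group \<Gamma>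
  for \<Gamma> :: "('o, 'm) two_group_data" +
  fixes G :: "'g monoid"
    and act :: "'g \<Rightarrow> 'a::ab_group_add \<Rightarrow> 'a"
    and p :: "'o \<Rightarrow> 'g"
    and i :: "'a \<Rightarrow> 'm"
  assumes G_group: "group G"
    and p_hom: "p \<in> hom (Obj \<Gamma>) G"
    and p_surj: "p ` carrier (Obj \<Gamma>) = carrier G"
    and p_eq_iff: "\<lbrakk>x \<in> carrier (Obj \<Gamma>); y \<in> carrier (Obj \<Gamma>)\<rbrakk>
          \<Longrightarrow> p x = p y \<longleftrightarrow> (\<exists>f\<in>carrier (Mor \<Gamma>). src \<Gamma> f = x \<and> tgt \<Gamma> f = y)"
    and i_bij: "bij_betw i UNIV
          {f \<in> carrier (Mor \<Gamma>). src \<Gamma> f = \<one>\<^bsub>Obj \<Gamma>\<^esub> \<and> tgt \<Gamma> f = \<one>\<^bsub>Obj \<Gamma>\<^esub>}"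
    and i_add: "i (a + b) = vcomp \<Gamma> (i a) (i b)"
    and i_act: "x \<in> carrier (Obj \<Gamma>)
          \<Longrightarrow> i (act (p x) a) = idm \<Gamma> x \<otimes>\<^bsub>Mor \<Gamma>\<^esub> i a \<otimes>\<^bsub>Mor \<Gamma>\<^esub> inv\<^bsub>Mor \<Gamma>\<^esub> (idm \<Gamma> x)"

text \<open>\<open>\<xi>\<close> is the cocycle determined by a normalised section \<open>S\<close> and normalised isomorphisms \<open>\<beta>\<close>.\<close>

definition k_cocycle ::
  "('o, 'm) two_group_data \<Rightarrow> 'g monoid \<Rightarrow> ('o \<Rightarrow> 'g) \<Rightarrow> ('a \<Rightarrow> 'm) \<Rightarrow>
   ('g \<Rightarrow> 'o) \<Rightarrow> ('g \<Rightarrow> 'g \<Rightarrow> 'm) \<Rightarrow> ('g \<Rightarrow> 'g \<Rightarrow> 'g \<Rightarrow> 'a::ab_group_add) \<Rightarrow> bool" where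
  "k_cocycle \<Gamma> G p i S \<beta> \<xi> \<longleftrightarrow>
     (\<forall>g\<in>carrier G. S g \<in> carrier (Obj \<Gamma>) \<and> p (S g) = g) \<and>
     S \<one>\<^bsub>G\<^esub> = \<one>\<^bsub>Obj \<Gamma>\<^esub> \<and>
     (\<forall>g\<in>carrier G. \<forall>h\<in>carrier G. \<beta> g h \<in> carrier (Mor \<Gamma>) \<and>
        src \<Gamma> (\<beta> g h) = S g \<otimes>\<^bsub>Obj \<Gamma>\<^esub> S h \<and> tgt \<Gamma> (\<beta> g h) = S (g \<otimes>\<^bsub>G\<^esub> h)) \<and>
     (\<forall>g\<in>carrier G. \<beta> \<one>\<^bsub>G\<^esub> g = idm \<Gamma> (S g) \<and> \<beta> g \<one>\<^bsub>G\<^esub> = idm \<Gamma> (S g)) \<and>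
     (\<forall>g\<in>carrier G. \<forall>h\<in>carrier G. \<forall>k\<in>carrier G.
        vcomp \<Gamma>
          (vcomp \<Gamma> (i (\<xi> g h k) \<otimes>\<^bsub>Mor \<Gamma>\<^esub> idm \<Gamma> (S (g \<otimes>\<^bsub>G\<^esub> h \<otimes>\<^bsub>G\<^esub> k))) (\<beta> (g \<otimes>\<^bsub>G\<^esub> h) k))
          (\<beta> g h \<otimes>\<^bsub>Mor \<Gamma>\<^esub> idm \<Gamma> (S k))
        = vcomp \<Gamma> (\<beta> g (h \<otimes>\<^bsub>G\<^esub> k)) (idm \<Gamma> (S g) \<otimes>\<^bsub>Mor \<Gamma>\<^esub> \<beta> h k))"

text \<open>The definite description expresses that all choices of \<open>S\<close> and \<open>\<beta>\<close> give the same class.\<close>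

definition k_invariant ::
  "('o, 'm) two_group_data \<Rightarrow> 'g monoid \<Rightarrow> ('g \<Rightarrow> 'a \<Rightarrow> 'a) \<Rightarrow> ('o \<Rightarrow> 'g) \<Rightarrow> ('a \<Rightarrow> 'm) \<Rightarrow>
   ('g \<Rightarrow> 'g \<Rightarrow> 'g \<Rightarrow> 'a::ab_group_add) set" where
  "k_invariant \<Gamma> G act p i =
     (THE \<kappa>. \<exists>S \<beta> \<xi>. k_cocycle \<Gamma> G p i S \<beta> \<xi> \<and> \<kappa> = H3_class G act \<xi>)"


section \<open>The split orthogonal group\<close>

text \<open>
  The index set of size \<open>2n\<close> is the type \<open>'n + 'n\<close> with \<open>n = CARD('n)\<close>; the indices \<open>Inl k\<close>
  form the first block and the indices \<open>Inr k\<close> the second.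
\<close>

type_synonym 'n zmat = "int ^ ('n + 'n) ^ ('n + 'n)"
type_synonym 'n zvec = "int ^ ('n + 'n)"
type_synonym 'n rvec = "real ^ ('n + 'n)"

definition Jmat :: "'n::finite zmat" where
  "Jmat = (\<chi> r c. case (r, c) of (Inr k, Inl l) \<Rightarrow> if k = l then 1 else 0 | _ \<Rightarrow> 0)"

definition Imat :: "'n::finite zmat" where
  "Imat = (\<chi> r c. case (r, c) of
     (Inl k, Inr l) \<Rightarrow> if k = l then 1 else 0
   | (Inr k, Inl l) \<Rightarrow> if k = l then 1 else 0
   | _ \<Rightarrow> 0)"

definition Opm :: "'n::finite zmat monoid" where
  "Opm = \<lparr>carrier = {A. invertible A \<and>
             (transpose A ** Imat ** A = Imat \<or> transpose A ** Imat ** A = - Imat)},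
          monoid.mult = (**), monoid.one = mat 1\<rparr>"

definition isosign :: "'n::finite zmat \<Rightarrow> int" where
  "isosign A = (THE e. transpose A ** Imat ** A = map_matrix ((*) e) Imat)"

definition Bmat :: "'n::finite zmat \<Rightarrow> 'n zmat" where
  "Bmat A = map_matrix ((*) (isosign A)) Jmat - transpose A ** Jmat ** A"

fun index_less :: "'n::linorder + 'n \<Rightarrow> 'n + 'n \<Rightarrow> bool" where
  "index_less (Inl k) (Inl l) = (k < l)"
| "index_less (Inl k) (Inr l) = True"
| "index_less (Inr k) (Inl l) = False"
| "index_less (Inr k) (Inr l) = (k < l)"

definition low :: "'n::{finite,linorder} zmat \<Rightarrow> 'n zmat" where
  "low B = (\<chi> r c. if index_less c r then B $ r $ c else 0)"

lemma index_less_irrefl: "\<not> index_less r r"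
  by (cases r) auto

lemma index_less_asym: "index_less r c \<Longrightarrow> \<not> index_less c r"
  by (cases r; cases c) auto

lemma index_less_total: "r \<noteq> c \<Longrightarrow> index_less r c \<or> index_less c r"
  by (cases r; cases c) auto

lemma low_characterization:
  assumes "transpose B = - B"
  shows "(\<forall>r c. \<not> index_less c r \<longrightarrow> L $ r $ c = 0) \<and> B = L - transpose L \<longleftrightarrow> L = low B"
proof -
  have skew: "B $ c $ r = - B $ r $ c" for r c
  proof -
    have "transpose B $ r $ c = (- B) $ r $ c" by (simp only: assms)
    then show ?thesis by (simp only: transpose_def vec_lambda_beta uminus_vec_def)
  qed
  have diag0: "B $ r $ r = 0" for r
    using skew[of r r] by linarith
  have "L = low B" if L: "\<forall>r c. \<not> index_less c r \<longrightarrow> L $ r $ c = 0" "B = L - transpose L"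
  proof -
    have "L $ r $ c = low B $ r $ c" for r c
    proof (cases "index_less c r")
      case True
      then have "L $ c $ r = 0" using L(1) index_less_asym by blast
      then show ?thesis using True L(2) by (simp add: low_def transpose_def)
    next
      case False
      then show ?thesis using L(1) by (simp add: low_def)
    qed
    then show ?thesis by (simp add: vec_eq_iff)
  qed
  moreover have "B $ r $ c = low B $ r $ c - low B $ c $ r" for r c
  proof (cases "r = c")
    case True
    then show ?thesis using diag0 by simp
  next
    case False
    then consider "index_less c r" "\<not> index_less r c" | "index_less r c" "\<not> index_less c r"
      using index_less_total index_less_asym by blast
    then show ?thesis
    proof cases
      case 1
      then show ?thesis by (simp add: low_def)
    next
      case 2
      then show ?thesis using skew[of c r] by (simp only: low_def vec_lambda_beta if_True if_False)
    qed
  qed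
  then have "B = low B - transpose (low B)"
    unfolding vec_eq_iff by (simp add: transpose_def)
  moreover have "\<forall>r c. \<not> index_less c r \<longrightarrow> low B $ r $ c = 0"
    by (simp add: low_def)
  ultimately show ?thesis by blast
qed

definition diagvec :: "'n::finite zmat \<Rightarrow> 'n zvec" where
  "diagvec M = (\<chi> r. M $ r $ r)"

definition rmat :: "'n::finite zmat \<Rightarrow> real ^ ('n + 'n) ^ ('n + 'n)" where
  "rmat = map_matrix real_of_int"

definition rvec :: "'n::finite zvec \<Rightarrow> 'n rvec" where
  "rvec m = (\<chi> r. real_of_int (m $ r))"

definition Opm_act :: "'n::finite zmat \<Rightarrow> 'n zvec \<Rightarrow> 'n zvec" where
  "Opm_act A m = (Imat ** A ** Imat) *v m"

definition m_expr :: "'n::{finite,linorder} zmat \<Rightarrow> 'n zmat \<Rightarrow> 'n zmat \<Rightarrow> 'n rvec" where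
  "m_expr A B C = (- 1 / 2) *\<^sub>R
     (rmat (matrix_inv (transpose A) ** matrix_inv (transpose B) ** matrix_inv (transpose C)) *v
      rvec (transpose C *v diagvec (transpose B ** low (Bmat A) ** B)
          + diagvec (transpose C ** low (Bmat (A ** B)) ** C)
          - isosign A *s diagvec (transpose C ** low (Bmat B) ** C)
          - diagvec (transpose C ** transpose B ** low (Bmat A) ** B ** C)))"


section \<open>The strict model of the automorphism 2-group\<close>

text \<open>
  The strict 2-group equivalent to the automorphism 2-group of the Lie 2-group
  \<open>TD\<^sub>n\<close>; the k-invariant of the latter is by definition that of this strict model. Its objects are
  pairs \<open>(A, \<eta>)\<close>, and a morphism is a triple of its source, the function \<open>\<beta>\<close> and its target.
\<close>

type_synonym 'n aobj = "'n zmat \<times> ('n rvec \<times> 'n rvec \<Rightarrow> circle)"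
type_synonym 'n amor = "'n aobj \<times> ('n rvec \<Rightarrow> circle) \<times> 'n aobj"

definition smooth_cocycle2 :: "('n::finite rvec \<times> 'n rvec \<Rightarrow> circle) \<Rightarrow> bool" where
  "smooth_cocycle2 \<eta> \<longleftrightarrow> smooth_circle \<eta> \<and>
     (\<forall>a b c. \<eta> (a, b) + \<eta> (a + b, c) = \<eta> (b, c) + \<eta> (a, b + c))"

definition is_aobj :: "'n::finite aobj \<Rightarrow> bool" where
  "is_aobj x \<longleftrightarrow> (case x of (A, \<eta>) \<Rightarrow>
     A \<in> carrier Opm \<and> smooth_cocycle2 \<eta> \<and>
     (\<forall>m m'. \<eta> (rvec m, rvec m') = 0) \<and>
     (\<forall>m a. \<eta> (rvec m, a) + zscale (isosign A) (of_real_circle (a \<bullet> (rmat Jmat *v rvec m)))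
          = \<eta> (a, rvec m)
            + of_real_circle ((rmat A *v a) \<bullet> (rmat Jmat *v (rmat A *v rvec m)))))"

definition amult :: "'n::finite aobj \<Rightarrow> 'n aobj \<Rightarrow> 'n aobj" where
  "amult x1 x2 = (case (x1, x2) of ((A1, \<eta>1), (A2, \<eta>2)) \<Rightarrow>
     (A1 ** A2, \<lambda>(a, b). \<eta>1 (rmat A2 *v a, rmat A2 *v b) + zscale (isosign A1) (\<eta>2 (a, b))))"

definition is_amor :: "'n::finite amor \<Rightarrow> bool" where
  "is_amor f \<longleftrightarrow> (case f of ((A, \<eta>), \<beta>, (A', \<eta>')) \<Rightarrow>
     is_aobj (A, \<eta>) \<and> is_aobj (A', \<eta>') \<and> A = A' \<and>
     smooth_circle \<beta> \<and> (\<forall>m. \<beta> (rvec m) = 0) \<and>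
     (\<forall>a1 a2. \<beta> a1 + \<beta> a2 + \<eta> (a1, a2) = \<eta>' (a1, a2) + \<beta> (a1 + a2)))"

definition strict_AUT_TD :: "('n::finite aobj, 'n amor) two_group_data" where
  "strict_AUT_TD = \<lparr>
     Obj = \<lparr>carrier = {x. is_aobj x}, monoid.mult = amult, monoid.one = (mat 1, \<lambda>_. 0)\<rparr>,
     Mor = \<lparr>carrier = {f. is_amor f},
            monoid.mult = (\<lambda>(x1, \<beta>1, y1) (x2, \<beta>2, y2).
              (amult x1 x2,
               \<lambda>a. \<beta>1 (rmat (fst x2) *v a) + zscale (isosign (fst x1)) (\<beta>2 a),
               amult y1 y2)),
            monoid.one = ((mat 1, \<lambda>_. 0), \<lambda>_. 0, (mat 1, \<lambda>_. 0))\<rparr>,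
     src = (\<lambda>(x, \<beta>, y). x),
     tgt = (\<lambda>(x, \<beta>, y). y),
     idm = (\<lambda>x. (x, \<lambda>_. 0, x)),
     vcomp = (\<lambda>(x', \<beta>', y') (x, \<beta>, y). (x, \<lambda>a. \<beta>' a + \<beta> a, y'))\<rparr>"

definition strict_AUT_TD_pi1 :: "'n::finite zvec \<Rightarrow> 'n amor" where
  "strict_AUT_TD_pi1 m = ((mat 1, \<lambda>_. 0), \<lambda>a. of_real_circle (rvec m \<bullet> a), (mat 1, \<lambda>_. 0))"

end

theory Submission
  imports Defs
begin

text \<open>
  All data of the strict model are functions with values in the circle and all compositions are
  additions, so the equation that determines \<open>\<xi>\<close> is an identity between circle-valued functions. If
  \<open>b g h\<close> is the function underlying the isomorphism \<open>S g \<cdot> S h \<rightarrow> S (gh)\<close>, it reads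
  \<open>\<xi> g h k \<cdot> ghka + b (gh) k a + b g h (ka) = b g (hk) a + iso(g) b h k a\<close>. After the substitution of
  \<open>b g h ((gh)\<^sup>-\<^sup>1a)\<close> for \<open>b g h a\<close> this says that \<open>\<xi>\<close>, regarded as a family of characters, is the coboundary
  of a 2-cochain with values in circle-valued functions. Hence \<open>\<xi>\<close> is a cocycle
  (\<open>cocycle_of_circle_cochain\<close>); it need not be the coboundary of an integral cochain, because the
  functions \<open>b g h\<close> need not be characters. For two choices of \<open>S\<close> and \<open>b\<close>, isomorphisms \<open>S g \<rightarrow> S' g\<close>
  correct the difference of the two cochains by a coboundary so that it does consist of
  characters; therefore the class is well defined (\<open>k_cocycles_cohomologous\<close>).

  The analytic part of the theorem is the computation of the isomorphism classes and of the
  automorphisms. Objects with the same matrix differ by a smooth circle-valued 2-cocycle \<open>d\<close> that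
  vanishes on pairs of integer vectors and satisfies \<open>d(m,a) = d(a,m)\<close> for integer \<open>m\<close>. Such a cocycle
  is trivial (\<open>smooth_cocycle2_trivial\<close>): it lifts to a real cocycle \<open>D\<close>, the commutator pairing
  \<open>D(a,b) - D(b,a)\<close> is additive in \<open>a\<close> and vanishes on integer vectors, so it is zero, and a
  symmetric smooth cocycle on a vector space is the coboundary of a smooth function
  (\<open>smooth_symmetric_cocycle_primitive\<close>). In the same way the automorphisms of the unit object are
  the characters of the torus (\<open>smooth_hom_eq_character\<close>).

  It remains to make one choice. The bilinear cocycle \<open>\<eta>\<^sub>A(a,b) = a \<cdot> \<B>(A)\<^sub>l\<^sub>o\<^sub>w b\<close> defines an object over
  \<open>A\<close>, since subtracting its transpose from \<open>\<B>(A)\<^sub>l\<^sub>o\<^sub>w\<close> gives \<open>\<B>(A)\<close>. The product of the objects over \<open>A\<close> and \<open>B\<close>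
  differs from the object over \<open>AB\<close> by a symmetric integral bilinear form \<open>q\<close>, which is
  trivialised by the quadratic function \<open>q(a,a)/2\<close>. This function is not zero modulo 1 on
  integer vectors, but since \<open>q(m,m)\<close> has the parity of \<open>diag(q) \<cdot> m\<close>, adding \<open>diag(q) \<cdot> a / 2\<close> repairs
  this. In the equation for \<open>\<xi>\<close> the quadratic terms cancel, and the linear ones add up to the
  expression for \<open>m\<close> in the theorem. The expression is integral because all other
  terms of that equation vanish at integer vectors.
\<close>


section \<open>Calculus of smooth functions\<close>

lemma Ck_on_SucD:
  assumes "Ck_on (Suc k) S f"
  shows "x \<in> S \<Longrightarrow> (f has_derivative frechet_derivative f (at x)) (at x)"
    and "Ck_on k S (\<lambda>x. frechet_derivative f (at x) v)"
  using assms frechet_derivative_works by auto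

text \<open>Smoothness involves Frechet derivatives at the points of an open set only, so it depends on the
  values of the function on that set alone. This is what allows the closure properties to be
  proved with a convenient formula for the derivative.\<close>

lemma Ck_on_cong:
  assumes "open S" "\<And>x. x \<in> S \<Longrightarrow> f x = g x" "Ck_on k S f"
  shows "Ck_on k S g"
  using assms
proof (induction k arbitrary: f g)
  case 0
  then show ?case using continuous_on_cong[of S S f g] by simp
next
  case (Suc k)
  have d: "(g has_derivative frechet_derivative f (at x)) (at x)" if x: "x \<in> S" for x
    using has_derivative_transform_within_open[OF Ck_on_SucD(1)[OF Suc.prems(3) x] Suc.prems(1) x]
      Suc.prems(2) by blast
  then have "frechet_derivative f (at x) = frechet_derivative g (at x)" if "x \<in> S" for x
    using that frechet_derivative_at by blast
  then have "Ck_on k S (\<lambda>x. frechet_derivative g (at x) v)" for v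
    using Suc.IH[OF Suc.prems(1) _ Ck_on_SucD(2)[OF Suc.prems(3), of v]] by simp
  then show ?case using d by (auto simp: differentiable_def)
qed

lemma Ck_on_SucI:
  assumes S: "open S" and d: "\<And>x. x \<in> S \<Longrightarrow> (f has_derivative f' x) (at x)"
    and k: "\<And>v. Ck_on k S (\<lambda>x. f' x v)"
  shows "Ck_on (Suc k) S f"
proof -
  have "f' x = frechet_derivative f (at x)" if "x \<in> S" for x
    using d[OF that] by (rule frechet_derivative_at)
  then have "Ck_on k S (\<lambda>x. frechet_derivative f (at x) v)" for v
    using Ck_on_cong[OF S _ k[of v]] by simp
  then show ?thesis
    using d by (auto simp: differentiable_def)
qed

lemma Ck_on_subset: "Ck_on k S f \<Longrightarrow> T \<subseteq> S \<Longrightarrow> Ck_on k T f"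
  by (induction k arbitrary: f) (auto intro: continuous_on_subset)

lemma Ck_on_local:
  assumes "\<And>x. x \<in> S \<Longrightarrow> \<exists>U. open U \<and> x \<in> U \<and> Ck_on k U f"
  shows "Ck_on k S f"
  using assms
proof (induction k arbitrary: f)
  case 0
  have "continuous (at x within S) f" if x: "x \<in> S" for x
  proof -
    obtain U where "open U" "x \<in> U" "Ck_on 0 U f" using 0 x by blast
    then have "isCont f x" by (simp add: continuous_on_eq_continuous_at)
    then show ?thesis by (rule continuous_at_imp_continuous_at_within)
  qed
  then show ?case by (simp add: continuous_on_eq_continuous_within)
next
  case (Suc k)
  have "\<exists>U. open U \<and> x \<in> U \<and> Ck_on k U (\<lambda>x. frechet_derivative f (at x) v)" if "x \<in> S" for x v
    using Suc.prems[OF that] by auto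
  moreover have "f differentiable (at x)" if "x \<in> S" for x
    using Suc.prems[OF that] by auto
  ultimately show ?case using Suc.IH by auto
qed

lemma Ck_on_const: "open S \<Longrightarrow> Ck_on k S (\<lambda>_. c)"
proof (induction k arbitrary: c)
  case (Suc k)
  then show ?case by (intro Ck_on_SucI[where f' = "\<lambda>_ _. 0"]) auto
qed simp

lemma Ck_on_add:
  assumes "open S" "Ck_on k S f" "Ck_on k S g"
  shows "Ck_on k S (\<lambda>x. f x + g x)"
  using assms
proof (induction k arbitrary: f g)
  case (Suc k)
  show ?case
    by (rule Ck_on_SucI[OF Suc.prems(1)
          has_derivative_add[OF Ck_on_SucD(1)[OF Suc.prems(2)] Ck_on_SucD(1)[OF Suc.prems(3)]]
          Suc.IH[OF Suc.prems(1) Ck_on_SucD(2)[OF Suc.prems(2)] Ck_on_SucD(2)[OF Suc.prems(3)]]])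
qed (simp add: continuous_on_add)

lemma Ck_on_mult_const:
  assumes "open S" "Ck_on k S f"
  shows "Ck_on k S (\<lambda>x. c * f x)"
  using assms
proof (induction k arbitrary: f)
  case (Suc k)
  show ?case
    by (rule Ck_on_SucI[OF Suc.prems(1)
          has_derivative_mult_right[OF Ck_on_SucD(1)[OF Suc.prems(2)]]
          Suc.IH[OF Suc.prems(1) Ck_on_SucD(2)[OF Suc.prems(2)]]])
qed (simp add: continuous_on_mult)

lemma Ck_on_compose_linear:
  assumes "open S" "open T" "bounded_linear L" "L ` T \<subseteq> S" "Ck_on k S f"
  shows "Ck_on k T (\<lambda>x. f (L x))"
  using assms
proof (induction k arbitrary: f)
  case 0
  then show ?case
    by (auto intro: continuous_on_compose2[of S f T L] linear_continuous_on)
next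
  case (Suc k)
  show ?case
  proof (rule Ck_on_SucI)
    fix x assume "x \<in> T"
    then have "L x \<in> S" using Suc.prems by blast
    from Ck_on_SucD(1)[OF Suc.prems(5) this]
    show "((\<lambda>x. f (L x)) has_derivative (\<lambda>v. frechet_derivative f (at (L x)) (L v))) (at x)"
      using has_derivative_compose[OF bounded_linear_imp_has_derivative[OF Suc.prems(3)]] by blast
  next
    show "Ck_on k T (\<lambda>x. frechet_derivative f (at (L x)) (L v))" for v
      using Suc.IH[OF Suc.prems(1-4) Ck_on_SucD(2)[OF Suc.prems(5)]] .
  qed (fact Suc.prems)
qed

lemma smooth_on_cong: "open S \<Longrightarrow> (\<And>x. x \<in> S \<Longrightarrow> f x = g x) \<Longrightarrow> smooth_on S f \<Longrightarrow> smooth_on S g"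
  unfolding smooth_on_def using Ck_on_cong by blast

lemma smooth_on_subset: "smooth_on S f \<Longrightarrow> T \<subseteq> S \<Longrightarrow> smooth_on T f"
  unfolding smooth_on_def using Ck_on_subset by blast

lemma smooth_on_local:
  "(\<And>x. x \<in> S \<Longrightarrow> \<exists>U. open U \<and> x \<in> U \<and> smooth_on U f) \<Longrightarrow> smooth_on S f"
  unfolding smooth_on_def using Ck_on_local by meson

lemma smooth_on_const: "open S \<Longrightarrow> smooth_on S (\<lambda>_. c)"
  by (simp add: smooth_on_def Ck_on_const)

lemma smooth_on_add: "open S \<Longrightarrow> smooth_on S f \<Longrightarrow> smooth_on S g \<Longrightarrow> smooth_on S (\<lambda>x. f x + g x)"
  by (simp add: smooth_on_def Ck_on_add)

lemma smooth_on_mult_const: "open S \<Longrightarrow> smooth_on S f \<Longrightarrow> smooth_on S (\<lambda>x. c * f x)"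
  by (simp add: smooth_on_def Ck_on_mult_const)

lemma smooth_on_diff: "open S \<Longrightarrow> smooth_on S f \<Longrightarrow> smooth_on S g \<Longrightarrow> smooth_on S (\<lambda>x. f x - g x)"
  using smooth_on_add[of S f "\<lambda>x. - 1 * g x"] smooth_on_mult_const[of S g "- 1"] by simp

lemma smooth_on_compose_linear:
  "open S \<Longrightarrow> open T \<Longrightarrow> bounded_linear L \<Longrightarrow> L ` T \<subseteq> S \<Longrightarrow> smooth_on S f \<Longrightarrow> smooth_on T (\<lambda>x. f (L x))"
  unfolding smooth_on_def using Ck_on_compose_linear by blast

lemma smooth_on_imp_continuous: "smooth_on S f \<Longrightarrow> continuous_on S f"
  unfolding smooth_on_def by (metis Ck_on.simps(1))

lemma smooth_on_has_derivative:
  assumes "smooth_on S f"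
  shows "x \<in> S \<Longrightarrow> (f has_derivative frechet_derivative f (at x)) (at x)"
    and "smooth_on S (\<lambda>x. frechet_derivative f (at x) v)"
  using assms unfolding smooth_on_def by (metis Ck_on_SucD(1), metis Ck_on_SucD(2))

text \<open>If the directional derivatives are already known to be smooth, differentiability once suffices.\<close>

lemma smooth_on_of_derivative:
  assumes "open S" "\<And>x. x \<in> S \<Longrightarrow> (f has_derivative f' x) (at x)" "\<And>v. smooth_on S (\<lambda>x. f' x v)"
  shows "smooth_on S f"
  unfolding smooth_on_def
proof
  fix k
  have Suc: "Ck_on (Suc k) S f" for k
    using assms by (intro Ck_on_SucI[of S f f']) (auto simp: smooth_on_def)
  show "Ck_on k S f"
  proof (cases k)
    case 0
    then show ?thesis
      using assms(2) by (auto intro!: continuous_at_imp_continuous_on has_derivative_continuous)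
  next
    case Suc': (Suc j)
    then show ?thesis using Suc by blast
  qed
qed

lemma smooth_on_bounded_linear: "bounded_linear f \<Longrightarrow> open S \<Longrightarrow> smooth_on S f"
  by (rule smooth_on_of_derivative[where f' = "\<lambda>_. f"])
    (auto intro: smooth_on_const bounded_linear_imp_has_derivative)

text \<open>The derivative of a quadratic map is linear, so no product rule for higher derivatives is needed.
  A bilinear map of two variables is the case where \<open>h\<close> reads off one component from each argument.\<close>

lemma smooth_on_quadratic:
  assumes h: "bounded_bilinear h" and S: "open S"
  shows "smooth_on S (\<lambda>x. h x x)"
proof (rule smooth_on_of_derivative[where f' = "\<lambda>x v. h x v + h v x"])
  show "((\<lambda>x. h x x) has_derivative (\<lambda>v. h x v + h v x)) (at x)" for x
    using bounded_bilinear.FDERIV[OF h has_derivative_ident has_derivative_ident] .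
  show "smooth_on S (\<lambda>x. h x v + h v x)" for v
    using bounded_linear_add[OF bounded_bilinear.bounded_linear_left[OF h]
        bounded_bilinear.bounded_linear_right[OF h]] S
    by (rule smooth_on_bounded_linear)
qed (fact S)


section \<open>Circle-valued maps and their real lifts\<close>

lemma of_real_circle_add: "of_real_circle (x + y) = of_real_circle x + of_real_circle y"
  by transfer simp

lemma of_real_circle_diff: "of_real_circle (x - y) = of_real_circle x - of_real_circle y"
  by transfer simp

lemma of_real_circle_0 [simp]: "of_real_circle 0 = 0"
  by transfer simp

lemma of_real_circle_eq_iff: "of_real_circle x = of_real_circle y \<longleftrightarrow> x - y \<in> \<int>"
  by transfer simp

lemma of_real_circle_eq_0_iff: "of_real_circle x = 0 \<longleftrightarrow> x \<in> \<int>"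
  using of_real_circle_eq_iff[of x 0] by simp

lemma zscale_of_real: "zscale k (of_real_circle x) = of_real_circle (real_of_int k * x)"
  by transfer simp

lemma zscale_add: "zscale k (x + y) = zscale k x + zscale k y"
  by transfer (simp add: algebra_simps)

lemma zscale_diff: "zscale k (x - y) = zscale k x - zscale k y"
  by transfer (simp add: algebra_simps)

lemma zscale_0 [simp]: "zscale k 0 = 0"
  by transfer simp

lemma zscale_zscale: "zscale k (zscale l x) = zscale (k * l) x"
  by transfer simp

lemma zscale_one [simp]: "zscale 1 x = x"
  by transfer simp

lemma zscale_uminus: "zscale (- k) x = - zscale k x"
  by transfer simp

lemma smooth_circleE:
  assumes "smooth_circle \<phi>"
  obtains U f where "open U" "x \<in> U" "smooth_on U f" "\<forall>y\<in>U. \<phi> y = of_real_circle (f y)"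
  using spec[OF assms[unfolded smooth_circle_def], of x] by (elim exE conjE) (rule that)

lemma smooth_circle_of_real: "smooth_on UNIV f \<Longrightarrow> smooth_circle (\<lambda>x. of_real_circle (f x))"
  unfolding smooth_circle_def by (intro allI exI[of _ UNIV] exI[of _ f]) simp

lemma smooth_circle_0 [simp]: "smooth_circle (\<lambda>_. 0)"
  using smooth_circle_of_real[OF smooth_on_const[of UNIV 0]] by simp

lemma smooth_circle_add:
  assumes "smooth_circle \<phi>" "smooth_circle \<psi>"
  shows "smooth_circle (\<lambda>x. \<phi> x + \<psi> x)"
  unfolding smooth_circle_def
proof
  fix x
  obtain U f where U: "open U" "x \<in> U" "smooth_on U f" "\<forall>y\<in>U. \<phi> y = of_real_circle (f y)"
    by (rule smooth_circleE[OF assms(1), where x = x])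
  obtain V g where V: "open V" "x \<in> V" "smooth_on V g" "\<forall>y\<in>V. \<psi> y = of_real_circle (g y)"
    by (rule smooth_circleE[OF assms(2), where x = x])
  have "smooth_on (U \<inter> V) (\<lambda>y. f y + g y)"
    by (rule smooth_on_add[OF open_Int[OF U(1) V(1)] smooth_on_subset[OF U(3) Int_lower1]
          smooth_on_subset[OF V(3) Int_lower2]])
  then show "\<exists>W h. open W \<and> x \<in> W \<and> smooth_on W h \<and> (\<forall>y\<in>W. \<phi> y + \<psi> y = of_real_circle (h y))"
    using U V by (intro exI[of _ "U \<inter> V"] exI[of _ "\<lambda>y. f y + g y"] conjI ballI)
      (simp_all add: of_real_circle_add open_Int)
qed

lemma smooth_circle_zscale:
  assumes "smooth_circle \<phi>"
  shows "smooth_circle (\<lambda>x. zscale k (\<phi> x))"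
  unfolding smooth_circle_def
proof
  fix x
  obtain U f where U: "open U" "x \<in> U" "smooth_on U f" "\<forall>y\<in>U. \<phi> y = of_real_circle (f y)"
    by (rule smooth_circleE[OF assms, where x = x])
  show "\<exists>W h. open W \<and> x \<in> W \<and> smooth_on W h \<and> (\<forall>y\<in>W. zscale k (\<phi> y) = of_real_circle (h y))"
    using U smooth_on_mult_const[OF U(1,3), of "real_of_int k"]
    by (intro exI[of _ U] exI[of _ "\<lambda>y. real_of_int k * f y"]) (auto simp: zscale_of_real)
qed

lemma smooth_circle_minus: "smooth_circle \<phi> \<Longrightarrow> smooth_circle (\<lambda>x. - \<phi> x)"
  using smooth_circle_zscale[of \<phi> "- 1"] by (simp add: zscale_uminus)

lemma smooth_circle_diff: "smooth_circle \<phi> \<Longrightarrow> smooth_circle \<psi> \<Longrightarrow> smooth_circle (\<lambda>x. \<phi> x - \<psi> x)"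
  using smooth_circle_add[OF _ smooth_circle_minus, of \<phi> \<psi>] by simp

lemma smooth_circle_compose_linear:
  assumes "smooth_circle \<phi>" and L: "bounded_linear L"
  shows "smooth_circle (\<lambda>x. \<phi> (L x))"
  unfolding smooth_circle_def
proof
  fix x
  obtain U f where U: "open U" "L x \<in> U" "smooth_on U f" "\<forall>y\<in>U. \<phi> y = of_real_circle (f y)"
    by (rule smooth_circleE[OF assms(1), where x = "L x"])
  have op: "open (L -` U)"
    using U(1) L by (intro open_vimage linear_continuous_on)
  then have "smooth_on (L -` U) (\<lambda>y. f (L y))"
    by (rule smooth_on_compose_linear[OF U(1) _ L _ U(3)]) auto
  then show "\<exists>W h. open W \<and> x \<in> W \<and> smooth_on W h \<and> (\<forall>y\<in>W. \<phi> (L y) = of_real_circle (h y))"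
    using U(2,4) op by (intro exI[of _ "L -` U"] exI[of _ "\<lambda>y. f (L y)"] conjI ballI) simp_all
qed

lemma continuous_Ints_constant:
  fixes f :: "'a::topological_space \<Rightarrow> real"
  assumes "connected S" "continuous_on S f" "\<And>x. x \<in> S \<Longrightarrow> f x \<in> \<int>" "x \<in> S" "y \<in> S"
  shows "f x = f y"
proof -
  have "f constant_on S"
  proof (rule continuous_discrete_range_constant[OF assms(1,2)])
    fix x assume x: "x \<in> S"
    have "1 \<le> norm (f y - f x)" if "y \<in> S" "f y \<noteq> f x" for y
      using Ints_nonzero_abs_ge1[OF Ints_diff[OF assms(3)[OF that(1)] assms(3)[OF x]]] that(2) by simp
    then show "\<exists>e>0. \<forall>y. y \<in> S \<and> f y \<noteq> f x \<longrightarrow> e \<le> norm (f y - f x)"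
      by (intro exI[of _ 1]) auto
  qed
  then show ?thesis using assms(4,5) unfolding constant_on_def by auto
qed

lift_definition circle_exp :: "circle \<Rightarrow> complex" is "\<lambda>x. cis (2 * pi * x)"
proof -
  fix x y :: real assume "x - y \<in> \<int>"
  then obtain k where "x - y = of_int k" by (rule Ints_cases)
  then have "x = y + of_int k" by linarith
  then have "cis (2 * pi * x) = cis (2 * pi * y) * cis (2 * pi * of_int k)"
    by (simp only: distrib_left cis_mult)
  then show "cis (2 * pi * x) = cis (2 * pi * y)"
    by (simp add: cis_multiple_2pi)
qed

lemma circle_exp_eq_iff: "circle_exp \<phi> = circle_exp \<psi> \<longleftrightarrow> \<phi> = \<psi>"
proof transfer
  fix x y :: real
  have "cis (2 * pi * x) = cis (2 * pi * y) \<longleftrightarrow> cis (2 * pi * (x - y)) = 1"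
  proof -
    have "cis (2 * pi * (x - y)) = cis (2 * pi * x) / cis (2 * pi * y)"
      by (simp only: right_diff_distrib cis_divide)
    then show ?thesis by simp
  qed
  also have "\<dots> \<longleftrightarrow> cos (2 * pi * (x - y)) = 1"
  proof -
    have "sin t = 0" if "cos t = 1" for t :: real
      using that cos_one_sin_zero by blast
    then show ?thesis by (auto simp: complex_eq_iff simp del: cos_one_2pi)
  qed
  also have "\<dots> \<longleftrightarrow> (\<exists>k::int. x - y = k)"
  proof -
    have "2 * pi * (x - y) = of_int k * 2 * pi \<longleftrightarrow> x - y = of_int k" for k :: int
    proof -
      have "2 * pi * (x - y) = of_int k * 2 * pi \<longleftrightarrow> (2 * pi) * (x - y) = (2 * pi) * of_int k"
        by (simp only: mult.commute mult.left_commute)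
      then show ?thesis by simp
    qed
    then show ?thesis by (simp only: cos_one_2pi_int)
  qed
  also have "\<dots> \<longleftrightarrow> x - y \<in> \<int>"
    unfolding Ints_def by blast
  finally show "(cis (2 * pi * x) = cis (2 * pi * y)) = (x - y \<in> \<int>)" .
qed

text \<open>The exponential turns a circle-valued map into a continuous map to the nonzero complex numbers,
  which has a continuous logarithm because the vector space is contractible. Near each point the
  resulting lift differs from a smooth local lift by a continuous integer-valued function, that is, by a
  constant; so it is smooth as well.\<close>

lemma smooth_circle_lift:
  fixes \<phi> :: "'a::euclidean_space \<Rightarrow> circle"
  assumes \<phi>: "smooth_circle \<phi>" and 0: "\<phi> 0 = 0"
  obtains f where "smooth_on UNIV f" "\<And>x. \<phi> x = of_real_circle (f x)" "f 0 = 0"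
proof -
  have "isCont (\<lambda>x. circle_exp (\<phi> x)) x" for x
  proof -
    obtain U f where U: "open U" "x \<in> U" "smooth_on U f" "\<forall>y\<in>U. \<phi> y = of_real_circle (f y)"
      by (rule smooth_circleE[OF \<phi>, where x = x])
    have "continuous_on U (\<lambda>y. cis (2 * pi * f y))"
      using smooth_on_imp_continuous[OF U(3)] by (intro continuous_intros)
    moreover have "circle_exp (\<phi> y) = cis (2 * pi * f y)" if "y \<in> U" for y
      using bspec[OF U(4) that] by (simp add: circle_exp.abs_eq of_real_circle.abs_eq)
    ultimately have "continuous_on U (\<lambda>x. circle_exp (\<phi> x))"
      using continuous_on_cong by (metis (no_types, lifting))
    then show ?thesis using U(1,2) by (simp add: continuous_on_eq_continuous_at)
  qed
  then have "continuous_on UNIV (\<lambda>x. circle_exp (\<phi> x))"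
    by (simp add: continuous_on_eq_continuous_at)
  moreover have norm1: "norm (circle_exp z) = 1" for z
    by transfer simp
  then have "circle_exp z \<noteq> 0" for z
    by (metis norm_zero zero_neq_one)
  ultimately obtain g where g: "continuous_on UNIV g" "\<And>x. circle_exp (\<phi> x) = exp (g x)"
    using continuous_logarithm_on_contractible[of UNIV "\<lambda>x. circle_exp (\<phi> x)"] contractible_UNIV by auto
  define F where "F x = (Im (g x) - Im (g 0)) / (2 * pi)" for x
  define G where "G x = Im (g x) / (2 * pi)" for x
  have Re: "Re (g x) = 0" for x
    using norm1[of "\<phi> x"] by (simp add: g(2))
  have G: "\<phi> x = of_real_circle (G x)" for x
  proof -
    have "circle_exp (of_real_circle (G x)) = cis (Im (g x))"
      by (simp add: circle_exp.abs_eq of_real_circle.abs_eq G_def)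
    also have "\<dots> = circle_exp (\<phi> x)"
      using Re[of x] by (simp add: g(2) exp_eq_polar)
    finally show ?thesis by (simp add: circle_exp_eq_iff)
  qed
  have F: "\<phi> x = of_real_circle (F x)" for x
    using G[of x] G[of 0] 0 by (simp add: F_def G_def diff_divide_distrib of_real_circle_diff)
  have contF: "continuous_on S F" for S
    using g(1) unfolding F_def by (intro continuous_intros continuous_on_subset[OF g(1)]) auto
  have "smooth_on UNIV F"
  proof (rule smooth_on_local)
    fix x
    obtain U f where U: "open U" "x \<in> U" "smooth_on U f" "\<forall>y\<in>U. \<phi> y = of_real_circle (f y)"
      by (rule smooth_circleE[OF \<phi>, where x = x])
    then obtain e where e: "e > 0" "ball x e \<subseteq> U" using openE by blast
    have f: "smooth_on (ball x e) f" using U(3) e(2) by (rule smooth_on_subset)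
    have "F y - f y = F x - f x" if y: "y \<in> ball x e" for y
    proof (rule continuous_Ints_constant[of "ball x e"])
      show "continuous_on (ball x e) (\<lambda>y. F y - f y)"
        using contF smooth_on_imp_continuous[OF f] by (intro continuous_intros)
      show "F z - f z \<in> \<int>" if "z \<in> ball x e" for z
        using U(4) F[of z] that e(2) by (metis of_real_circle_eq_iff subsetD)
    qed (use y e in auto)
    then have "f y + (F x - f x) = F y" if "y \<in> ball x e" for y
      using that by (simp add: algebra_simps)
    then have "smooth_on (ball x e) F"
      using smooth_on_cong[OF open_ball _ smooth_on_add[OF open_ball f smooth_on_const[OF open_ball]]]
      by blast
    then show "\<exists>U. open U \<and> x \<in> U \<and> smooth_on U F"
      using e(1) by (intro exI[of _ "ball x e"]) auto
  qed
  then show ?thesis using that F by (simp add: F_def)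
qed


section \<open>Symmetric smooth cocycles on a vector space\<close>

text \<open>If \<open>D(a,b) = f(a+b) - f(a) - f(b)\<close> with \<open>f'(0) = 0\<close>, then \<open>f'(x)v\<close> must be \<open>g(x,v)\<close>, the derivative of \<open>D(x,\<cdot>)\<close>
  at 0 in direction \<open>v\<close>. So \<open>f\<close> is defined by integrating \<open>g\<close> along rays. The cocycle identity and
  symmetry express both partial derivatives of \<open>D\<close> by \<open>g\<close>, and then both sides of the desired equation
  have the same derivative along the ray through \<open>(a,b)\<close>. The equation itself shows that \<open>f\<close> is
  differentiable everywhere once it is at 0, with derivative \<open>g\<close>; this avoids
  differentiating under the integral sign.\<close>

lemma smooth_symmetric_cocycle_primitive:
  fixes D :: "'a::euclidean_space \<times> 'a \<Rightarrow> real"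
  assumes smooth: "smooth_on UNIV D"
    and sym: "\<And>a b. D (a, b) = D (b, a)"
    and coc: "\<And>a b c. D (a, b) + D (a + b, c) = D (b, c) + D (a, b + c)"
    and D0: "D (0, 0) = 0"
  obtains f where "smooth_on UNIV f" "\<And>a b. D (a, b) = f (a + b) - f a - f b"
proof -
  define D' where "D' p = frechet_derivative D (at p)" for p
  have D': "(D has_derivative D' p) (at p)" for p
    unfolding D'_def using smooth_on_has_derivative(1)[OF smooth] by simp
  have linD': "linear (D' p)" for p
    using D' has_derivative_linear by blast
  define g where "g x v = D' (x, 0) (0, v)" for x v
  have g_smooth: "smooth_on UNIV (\<lambda>x. g x v)" for v
  proof -
    have "bounded_linear (\<lambda>x::'a. (x, 0::'a))"
      by (intro bounded_linear_Pair bounded_linear_ident bounded_linear_zero)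
    from smooth_on_compose_linear[OF open_UNIV open_UNIV this _ smooth_on_has_derivative(2)[OF smooth]]
    show ?thesis unfolding g_def D'_def by simp
  qed
  have g_cont: "continuous_on S (\<lambda>x. g x v)" for S v
    using smooth_on_imp_continuous[OF g_smooth] continuous_on_subset by blast
  have g_lin: "linear (g x)" for x
  proof -
    have "linear (D' (x, 0) \<circ> (\<lambda>v. (0, v)))"
      by (intro linear_compose linD') (auto intro!: linearI)
    then show ?thesis by (simp add: g_def[abs_def] o_def)
  qed
  have d2: "((\<lambda>c. D (b, c)) has_derivative (\<lambda>v. D' (b, c) (0, v))) (at c)" for b c
    using has_derivative_compose[OF has_derivative_Pair[OF has_derivative_const has_derivative_ident] D'] .
  have d1: "((\<lambda>c. D (c, b)) has_derivative (\<lambda>v. D' (c, b) (v, 0))) (at c)" for b c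
    using has_derivative_compose[OF has_derivative_Pair[OF has_derivative_ident has_derivative_const] D'] .
  \<comment> \<open>differentiate the cocycle identity in its third argument at 0\<close>
  have D'2: "D' (a, b) (0, v) = g (a + b) v - g b v" for a b v
  proof -
    have "((\<lambda>c. D (a, b) + D (a + b, c)) has_derivative (\<lambda>v. 0 + g (a + b) v)) (at 0)"
      unfolding g_def by (intro has_derivative_add has_derivative_const d2)
    moreover have shift: "((\<lambda>c. D (a, b + c)) has_derivative (\<lambda>v. D' (a, b) (0, v))) (at 0)"
      using has_derivative_compose[OF has_derivative_add[OF has_derivative_const has_derivative_ident]
          d2[of a "b + 0"]] by simp
    then have "((\<lambda>c. D (b, c) + D (a, b + c)) has_derivative (\<lambda>v. g b v + D' (a, b) (0, v))) (at 0)"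
      unfolding g_def by (intro has_derivative_add d2)
    ultimately have "(\<lambda>v. 0 + g (a + b) v) = (\<lambda>v. g b v + D' (a, b) (0, v))"
      unfolding coc by (rule has_derivative_unique)
    from fun_cong[OF this, of v] show ?thesis by simp
  qed
  have D'1: "D' (a, b) (v, 0) = g (a + b) v - g a v" for a b v
  proof -
    have "(\<lambda>v. D' (a, b) (v, 0)) = (\<lambda>v. D' (b, a) (0, v))"
      using d1[of b a] d2[of b a] unfolding sym[of _ b] by (rule has_derivative_unique)
    from fun_cong[OF this, of v] show ?thesis by (simp add: D'2 add.commute)
  qed
  have D'12: "D' (a, b) (u, v) = D' (a, b) (u, 0) + D' (a, b) (0, v)" for a b u v
    using linear_add[OF linD', of "(a, b)" "(u, 0)" "(0, v)"] by simp
  have Dz: "D (0, a) = 0" for a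
    using coc[of 0 0 a] D0 by simp
  have g0: "g 0 v = 0" for v
  proof -
    have "((\<lambda>c. 0 :: real) has_derivative (\<lambda>v. D' (0, 0) (0, v))) (at 0)"
      using d2[of 0 0] by (simp add: Dz)
    from has_derivative_unique[OF this has_derivative_const]
    show ?thesis by (simp add: g_def fun_eq_iff)
  qed
  define f where "f a = integral {0..1} (\<lambda>t. g (t *\<^sub>R a) a)" for a
  have f0: "f 0 = 0"
    by (simp add: f_def g0)
  have f_ray: "((\<lambda>s. f (s *\<^sub>R a)) has_real_derivative g (s *\<^sub>R a) a) (at s within {0..1})"
    if s: "s \<in> {0..1}" for s a
  proof -
    have "continuous_on {0..1} (\<lambda>t. g (t *\<^sub>R a) a)"
      by (rule continuous_on_compose2[OF g_cont[of UNIV]]) (auto intro!: continuous_intros)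
    then obtain P where P: "\<And>x. x \<in> {0..1} \<Longrightarrow>
        (P has_vector_derivative g (x *\<^sub>R a) a) (at x within {0..1::real})"
      using antiderivative_continuous by blast
    have "f (r *\<^sub>R a) = P r - P 0" if r: "r \<in> {0..1}" for r
    proof -
      have "((\<lambda>t. g (t *\<^sub>R (r *\<^sub>R a)) (r *\<^sub>R a)) has_integral P (r * 1) - P (r * 0)) {0..1}"
      proof (rule fundamental_theorem_of_calculus)
        fix t :: real assume t: "t \<in> {0..1}"
        then have rt: "r * t \<in> {0..1}" using r by (auto intro: mult_le_one)
        have im: "(*) r ` {0..1} \<subseteq> {0..1}" using r by (auto intro: mult_le_one)
        have "(P has_real_derivative g ((r * t) *\<^sub>R a) a) (at (r * t) within (*) r ` {0..1})"
          using P[OF rt] has_field_derivative_subset[OF _ im]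
          by (simp add: has_real_derivative_iff_has_vector_derivative)
        from DERIV_image_chain[OF this, of r]
        have "((P \<circ> (*) r) has_real_derivative g ((r * t) *\<^sub>R a) a * r) (at t within {0..1})"
          by (auto intro!: derivative_eq_intros)
        then show "((\<lambda>t. P (r * t)) has_vector_derivative g (t *\<^sub>R (r *\<^sub>R a)) (r *\<^sub>R a)) (at t within {0..1})"
          by (simp add: has_real_derivative_iff_has_vector_derivative linear_scale[OF g_lin] o_def mult.commute)
      qed simp
      then show ?thesis
        unfolding f_def by (simp add: integral_unique)
    qed
    then have eq: "P r - P 0 = f (r *\<^sub>R a)" if "r \<in> {0..1}" for r
      using that by simp
    have "((\<lambda>r. P r - P 0) has_real_derivative g (s *\<^sub>R a) a) (at s within {0..1})"
      using P[OF s] by (auto simp flip: has_real_derivative_iff_has_vector_derivative intro!: derivative_eq_intros)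
    then show ?thesis
      by (rule has_field_derivative_transform_within[where d = 1]) (use s eq in auto)
  qed
  \<comment> \<open>both sides agree at \<open>s = 0\<close> and have the same derivative along the ray \<open>s(a,b)\<close>\<close>
  have f_D: "D (a, b) = f (a + b) - f a - f b" for a b
  proof -
    define h where "h s = f (s *\<^sub>R (a + b)) - f (s *\<^sub>R a) - f (s *\<^sub>R b) - D (s *\<^sub>R a, s *\<^sub>R b)" for s
    have "(h has_real_derivative 0) (at s within {0..1})" if s: "s \<in> {0..1}" for s
    proof -
      have "((\<lambda>s. D (s *\<^sub>R a, s *\<^sub>R b)) has_derivative (\<lambda>r. D' (s *\<^sub>R a, s *\<^sub>R b) (r *\<^sub>R a, r *\<^sub>R b))) (at s within {0..1})"
        by (rule has_derivative_compose[OF _ D']) (auto intro!: derivative_eq_intros)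
      then have D_ray: "((\<lambda>s. D (s *\<^sub>R a, s *\<^sub>R b)) has_real_derivative D' (s *\<^sub>R a, s *\<^sub>R b) (a, b)) (at s within {0..1})"
        using linear_scale[OF linD', of _ _ "(a, b)"]
        by (simp add: has_field_derivative_def mult.commute[of "D' _ _"] mult_commute_abs)
      have "g (s *\<^sub>R (a + b)) (a + b) - g (s *\<^sub>R a) a - g (s *\<^sub>R b) b - D' (s *\<^sub>R a, s *\<^sub>R b) (a, b) = 0"
        using D'12[of "s *\<^sub>R a" "s *\<^sub>R b" a b]
        by (simp add: D'1 D'2 linear_add[OF g_lin] scaleR_add_right)
      then show ?thesis
        unfolding h_def
        using DERIV_diff[OF DERIV_diff[OF DERIV_diff[OF f_ray[OF s, of "a + b"] f_ray[OF s, of a]]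
              f_ray[OF s, of b]] D_ray] by simp
    qed
    then obtain c where "\<And>s. s \<in> {0..1} \<Longrightarrow> h s = c"
      using has_field_derivative_zero_constant[of "{0..1}" h] convex_real_interval by auto
    then have "h 1 = h 0" by simp
    then show ?thesis by (simp add: h_def f0 D0)
  qed
  define G where "G x = (\<Sum>i\<in>Basis. \<bar>g x i\<bar>)" for x
  have g_bound: "\<bar>g x v\<bar> \<le> G x * norm v" for x v
  proof -
    have "g x v = g x (\<Sum>i\<in>Basis. (v \<bullet> i) *\<^sub>R i)"
      by (simp add: euclidean_representation)
    also have "\<dots> = (\<Sum>i\<in>Basis. (v \<bullet> i) * g x i)"
      by (simp add: linear_sum[OF g_lin] linear_scale[OF g_lin])
    also have "\<bar>\<dots>\<bar> \<le> (\<Sum>i\<in>Basis. \<bar>g x i\<bar> * norm v)"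
      by (rule order_trans[OF sum_abs sum_mono])
        (auto simp: abs_mult mult.commute intro!: mult_right_mono Basis_le_norm)
    finally show ?thesis by (simp add: G_def sum_distrib_right)
  qed
  have f_deriv0: "(f has_derivative (\<lambda>_. 0)) (at 0)"
    unfolding has_derivative_at_alt
  proof (intro conjI allI impI)
    fix e :: real assume e: "e > 0"
    have "continuous_on UNIV G"
      unfolding G_def by (intro continuous_intros g_cont)
    then have "isCont G 0"
      by (simp add: continuous_on_eq_continuous_at)
    moreover have "G 0 = 0" by (simp add: G_def g0)
    ultimately obtain d where d: "d > 0" "\<And>x. norm x < d \<Longrightarrow> \<bar>G x\<bar> < e"
      using e unfolding continuous_at_eps_delta by (auto simp: dist_norm)
    show "\<exists>d>0. \<forall>y. norm (y - 0) < d \<longrightarrow> norm (f y - f 0 - 0) \<le> e * norm (y - 0)"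
    proof (intro exI conjI allI impI)
      fix y :: 'a assume y: "norm (y - 0) < d"
      have "norm (integral {0..1} (\<lambda>t. g (t *\<^sub>R y) y)) \<le> (e * norm y) * (1 - 0)"
      proof (rule integral_bound)
        show "continuous_on {0..1} (\<lambda>t. g (t *\<^sub>R y) y)"
          by (rule continuous_on_compose2[OF g_cont[of UNIV]]) (auto intro!: continuous_intros)
        fix t :: real assume t: "t \<in> {0..1}"
        have "norm (t *\<^sub>R y) \<le> norm y"
          using t by (simp add: mult_left_le_one_le)
        then have "G (t *\<^sub>R y) \<le> e" using d(2)[of "t *\<^sub>R y"] y by simp
        then show "norm (g (t *\<^sub>R y) y) \<le> e * norm y"
          using g_bound[of "t *\<^sub>R y" y] by (smt (verit) mult_right_mono norm_ge_zero real_norm_def)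
      qed simp
      then show "norm (f y - f 0 - 0) \<le> e * norm (y - 0)"
        by (simp add: f0) (simp add: f_def)
    qed (fact d(1))
  qed simp
  \<comment> \<open>\<open>f(y) = f(a) + f(y - a) + D(a, y - a)\<close>, where the middle term has derivative 0 at \<open>a\<close>\<close>
  have f_deriv: "(f has_derivative g a) (at a)" for a
  proof -
    have 1: "((\<lambda>y. f (y - a)) has_derivative (\<lambda>_. 0)) (at a)"
      using has_derivative_compose[OF has_derivative_diff[OF has_derivative_ident has_derivative_const],
          of f "\<lambda>_. 0" a a UNIV] f_deriv0 by simp
    have 2: "((\<lambda>y. D (a, y - a)) has_derivative g a) (at a)"
      using has_derivative_compose[OF has_derivative_diff[OF has_derivative_ident has_derivative_const],
          of "\<lambda>c. D (a, c)" "\<lambda>v. g a v" a a UNIV] d2[of a 0] by (simp add: g_def[abs_def])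
    have "((\<lambda>y. f a + f (y - a) + D (a, y - a)) has_derivative (\<lambda>v. 0 + 0 + g a v)) (at a)"
      by (intro has_derivative_add has_derivative_const 1 2)
    then show ?thesis by (simp add: f_D)
  qed
  have "smooth_on UNIV f"
    by (rule smooth_on_of_derivative[OF open_UNIV f_deriv g_smooth])
  then show ?thesis using f_D that by blast
qed


section \<open>Additive functions and integer vectors\<close>

lemma additive_zvec_eq_0:
  fixes h :: "int ^ 'k::finite \<Rightarrow> 'b::ab_group_add"
  assumes add: "\<And>x y. h (x + y) = h x + h y" and ax: "\<And>i. h (axis i 1) = 0"
  shows "h m = 0"
proof -
  have 0: "h 0 = 0" using add[of 0 0] by simp
  have axis_add: "axis i (k + l) = axis i k + (axis i l :: int ^ 'k)" for i k l
    by (simp add: axis_def vec_eq_iff)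
  have axk: "h (axis i k) = 0" for i k
  proof (induction k rule: int_induct[where k = 0])
    case base
    then show ?case using 0 by (simp add: axis_def zero_vec_def[symmetric])
  next
    case (step1 k)
    then show ?case by (simp add: axis_add add ax)
  next
    case (step2 k)
    then show ?case using add[of "axis i (k - 1)" "axis i 1"] by (simp add: ax flip: axis_add)
  qed
  have sum: "h (sum F A) = (\<Sum>i\<in>A. h (F i))" for F :: "'k \<Rightarrow> int ^ 'k" and A
    by (induction A rule: infinite_finite_induct) (simp_all add: add 0)
  have "m = (\<Sum>i\<in>UNIV. axis i (m $ i))"
    by (simp add: vec_eq_iff axis_def)
  then have "h m = h (\<Sum>i\<in>UNIV. axis i (m $ i))" by simp
  then show ?thesis by (simp add: sum axk)
qed

lemma rvec_nth [simp]: "rvec m $ i = real_of_int (m $ i)"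
  by (simp add: rvec_def)

lemma rvec_add: "rvec (m + m') = rvec m + rvec m'"
  by (simp add: vec_eq_iff)

lemma rvec_0 [simp]: "rvec 0 = 0"
  by (simp add: vec_eq_iff)

lemma rvec_axis: "rvec (axis i 1) = axis i 1"
  by (simp add: vec_eq_iff axis_def)

text \<open>An additive function that vanishes on the lattice is periodic, hence bounded by its values on the
  unit cube, and a bounded additive function is zero.\<close>

lemma additive_continuous_eq_0:
  fixes h :: "'n::finite rvec \<Rightarrow> real"
  assumes add: "\<And>x y. h (x + y) = h x + h y" and cont: "continuous_on UNIV h"
    and int: "\<And>m. h (rvec m) = 0"
  shows "h a = 0"
proof (rule ccontr)
  assume a: "h a \<noteq> 0"
  have "bounded (h ` cbox 0 (\<chi> i. 1))"
    by (intro compact_imp_bounded compact_continuous_image continuous_on_subset[OF cont]) auto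
  then obtain M where M: "\<And>x. x \<in> cbox 0 (\<chi> i. 1) \<Longrightarrow> \<bar>h x\<bar> \<le> M"
    unfolding bounded_iff by auto
  have bound: "\<bar>h x\<bar> \<le> M" for x
  proof -
    define r where "r = x - rvec (\<chi> i. \<lfloor>x $ i\<rfloor>)"
    have "r \<in> cbox 0 (\<chi> i. 1)"
      unfolding mem_box_cart r_def by (auto simp: floor_le_iff) linarith
    moreover have "h x = h r"
      using add[of r "rvec (\<chi> i. \<lfloor>x $ i\<rfloor>)"] int by (simp add: r_def)
    ultimately show ?thesis using M by simp
  qed
  have mult: "h (real k *\<^sub>R a) = real k * h a" for k
  proof (induction k)
    case 0
    then show ?case using int[of 0] by simp
  next
    case (Suc k)
    then show ?case by (simp add: scaleR_add_left add algebra_simps)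
  qed
  obtain k where "M < real k * \<bar>h a\<bar>"
    using reals_Archimedean3[of "\<bar>h a\<bar>"] a by auto
  then show False using bound[of "real k *\<^sub>R a"] by (simp add: mult abs_mult)
qed

lemma additive_continuous_eq_inner:
  fixes h :: "'n::finite rvec \<Rightarrow> real"
  assumes add: "\<And>x y. h (x + y) = h x + h y" and cont: "continuous_on UNIV h"
  shows "h a = (\<chi> i. h (axis i 1)) \<bullet> a"
proof -
  define c where "c = (\<chi> i. h (axis i 1))"
  define h' where "h' a = h a - c \<bullet> a" for a
  have add': "h' (x + y) = h' x + h' y" for x y
    by (simp add: h'_def add inner_add_right)
  have int': "h' (rvec m) = 0" for m
    by (rule additive_zvec_eq_0[where h = "\<lambda>m. h' (rvec m)"])
      (simp only: rvec_add add', simp add: rvec_axis h'_def c_def inner_axis)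
  have "continuous_on UNIV h'"
    unfolding h'_def by (intro continuous_intros cont)
  from additive_continuous_eq_0[OF add' this int'] have "h' a = 0" .
  then show ?thesis by (simp add: h'_def c_def)
qed


section \<open>Circle-valued homomorphisms and cocycles\<close>

text \<open>If \<open>v\<close> had a nonzero entry, its inner product with a suitable multiple of a basis vector would
  be one half.\<close>

lemma of_real_inner_eq_0D:
  fixes v :: "'n::finite rvec"
  assumes "\<And>a. of_real_circle (v \<bullet> a) = 0"
  shows "v = 0"
proof (rule ccontr)
  assume "v \<noteq> 0"
  then obtain i where i: "v $ i \<noteq> 0" by (auto simp: vec_eq_iff)
  have "v \<bullet> axis i (1 / (2 * v $ i)) = 1 / 2"
    using i by (simp add: inner_axis)
  then have "(1 / 2 :: real) \<in> \<int>"
    using assms[of "axis i (1 / (2 * v $ i))"] by (metis of_real_circle_eq_0_iff)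
  then obtain k where k: "(1 / 2 :: real) = of_int k" by (rule Ints_cases)
  then have "real_of_int (2 * k) = real_of_int 1" by simp
  then have "2 * k = 1" by (simp only: of_int_eq_iff)
  then show False by presburger
qed

lemma character_inject:
  assumes "\<And>a. of_real_circle (rvec m \<bullet> a) = of_real_circle (rvec m' \<bullet> a)"
  shows "m = m'"
proof -
  have "rvec m - rvec m' = 0"
    by (rule of_real_inner_eq_0D) (simp add: inner_diff_left of_real_circle_diff assms)
  then show ?thesis by (simp add: vec_eq_iff)
qed

text \<open>A continuous lift of the zero map is integer-valued, hence constant. This carries identities between
  circle-valued functions over to their real lifts.\<close>

lemma continuous_lift_of_0_eq_0:
  fixes F :: "'a::euclidean_space \<Rightarrow> real"
  assumes "continuous_on UNIV F" "\<And>x. of_real_circle (F x) = 0" "F 0 = 0"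
  shows "F x = 0"
  using continuous_Ints_constant[of UNIV F x 0] assms connected_UNIV
  by (simp add: of_real_circle_eq_0_iff)

text \<open>A lift of \<open>\<beta>\<close> is additive up to a continuous integer-valued function, hence additive and
  therefore linear. Its coefficients are its values at basis vectors, which are integers.\<close>

lemma smooth_hom_eq_character:
  fixes \<beta> :: "'n::finite rvec \<Rightarrow> circle"
  assumes smooth: "smooth_circle \<beta>" and add: "\<And>x y. \<beta> (x + y) = \<beta> x + \<beta> y"
    and int: "\<And>m. \<beta> (rvec m) = 0"
  obtains m where "\<And>a. \<beta> a = of_real_circle (rvec m \<bullet> a)"
proof -
  have \<beta>0: "\<beta> 0 = 0" using int[of 0] by simp
  obtain f where f: "smooth_on UNIV f" "\<And>x. \<beta> x = of_real_circle (f x)" "f 0 = 0"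
    using smooth_circle_lift[OF smooth \<beta>0] by blast
  have cont: "continuous_on S f" for S
    using smooth_on_imp_continuous[OF f(1)] continuous_on_subset by blast
  have "f (x + y) - f x - f y = 0" for x y
  proof -
    let ?F = "\<lambda>p. f (fst p + snd p) - f (fst p) - f (snd p)"
    have "?F (x, y) = 0"
    proof (rule continuous_lift_of_0_eq_0[of ?F])
      show "continuous_on UNIV ?F"
        by (intro continuous_intros continuous_on_compose2[OF cont[of UNIV]]) auto
      show "of_real_circle (?F p) = 0" for p
        using add[of "fst p" "snd p"] by (simp add: of_real_circle_diff flip: f(2))
    qed (simp add: f)
    then show ?thesis by simp
  qed
  then have fadd: "f (x + y) = f x + f y" for x y
    by (metis diff_diff_eq eq_iff_diff_eq_0)
  have "f (axis i 1) \<in> \<int>" for i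
    using int[of "axis i 1"] by (simp add: rvec_axis f(2) of_real_circle_eq_0_iff)
  then have "(\<chi> i. f (axis i 1)) = rvec (\<chi> i. \<lfloor>f (axis i 1)\<rfloor>)"
    by (simp add: vec_eq_iff)
  then have "\<beta> a = of_real_circle (rvec (\<chi> i. \<lfloor>f (axis i 1)\<rfloor>) \<bullet> a)" for a
    using additive_continuous_eq_inner[of f a, OF fadd cont] f(2) by simp
  then show ?thesis by (rule that)
qed

text \<open>The hypothesis \<open>sym\<close> kills the alternating bilinear form which is the only obstruction to
  triviality on a vector space. The hypothesis \<open>int\<close> makes the primitive a homomorphism modulo 1 on the
  lattice, so that subtracting a linear function makes it vanish there.\<close>

lemma smooth_cocycle2_trivial:
  fixes d :: "'n::finite rvec \<times> 'n rvec \<Rightarrow> circle"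
  assumes "smooth_cocycle2 d"
    and int: "\<And>m m'. d (rvec m, rvec m') = 0"
    and sym: "\<And>m a. d (rvec m, a) = d (a, rvec m)"
  obtains \<beta> where "smooth_circle \<beta>" "\<And>m. \<beta> (rvec m) = 0"
    "\<And>a b. \<beta> a + \<beta> b = d (a, b) + \<beta> (a + b)"
proof -
  have smooth: "smooth_circle d"
    and coc: "\<And>a b c. d (a, b) + d (a + b, c) = d (b, c) + d (a, b + c)"
    using assms(1) unfolding smooth_cocycle2_def by blast+
  have d0: "d 0 = 0" using int[of 0 0] by (simp add: zero_prod_def)
  obtain D where D: "smooth_on UNIV D" "\<And>p. d p = of_real_circle (D p)" "D 0 = 0"
    using smooth_circle_lift[OF smooth d0] by blast
  have cont: "continuous_on S D" for S
    using smooth_on_imp_continuous[OF D(1)] continuous_on_subset by blast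
  have D00: "D (0, 0) = 0" using D(3) by (simp add: zero_prod_def)
  have Dcoc: "D (a, b) + D (a + b, c) = D (b, c) + D (a, b + c)" for a b c
  proof -
    let ?F = "\<lambda>(a, b, c). D (a, b) + D (a + b, c) - D (b, c) - D (a, b + c)"
    have "?F (a, b, c) = 0"
    proof (rule continuous_lift_of_0_eq_0[of ?F])
      show "continuous_on UNIV ?F"
        unfolding case_prod_beta
        by (intro continuous_intros continuous_on_compose2[OF cont[of UNIV]]) auto
      show "of_real_circle (?F p) = 0" for p
        using coc[of "fst p" "fst (snd p)" "snd (snd p)"]
        by (simp add: case_prod_beta of_real_circle_diff of_real_circle_add flip: D(2))
    qed (simp add: zero_prod_def D00)
    then show ?thesis by simp
  qed
  \<comment> \<open>the commutator pairing\<close>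
  define \<omega> where "\<omega> a b = D (a, b) - D (b, a)" for a b
  have \<omega>_add: "\<omega> (a + b) c = \<omega> a c + \<omega> b c" for a b c
    using Dcoc[of a b c] Dcoc[of c a b] Dcoc[of a c b] unfolding \<omega>_def
    by (simp add: add.commute[of c])
  have \<omega>_cont: "continuous_on UNIV (\<lambda>a. \<omega> a b)" "continuous_on UNIV (\<lambda>b. \<omega> a b)" for a b
    unfolding \<omega>_def by (intro continuous_intros continuous_on_compose2[OF cont[of UNIV]]; auto)+
  have Dz: "D (0, a) = 0" "D (a, 0) = 0" for a
    using Dcoc[of 0 0 a] Dcoc[of a 0 0] D00 by simp_all
  have \<omega>_int: "\<omega> (rvec m) b = 0" for m b
  proof (rule continuous_lift_of_0_eq_0[of "\<omega> (rvec m)"])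
    show "continuous_on UNIV (\<omega> (rvec m))" using \<omega>_cont(2) by simp
    show "of_real_circle (\<omega> (rvec m) b) = 0" for b
      using sym[of m b] by (simp add: \<omega>_def of_real_circle_diff flip: D(2))
  qed (simp add: \<omega>_def Dz)
  have "\<omega> a b = 0" for a b
    by (rule additive_continuous_eq_0[of "\<lambda>a. \<omega> a b", OF \<omega>_add \<omega>_cont(1) \<omega>_int])
  then have Dsym: "D (a, b) = D (b, a)" for a b by (simp add: \<omega>_def)
  obtain f where f: "smooth_on UNIV f" "\<And>a b. D (a, b) = f (a + b) - f a - f b"
    using smooth_symmetric_cocycle_primitive[OF D(1) Dsym Dcoc D00] by blast
  \<comment> \<open>correct the primitive by a linear function so that it vanishes at the basis vectors\<close>
  define c where "c = (\<chi> i. f (axis i 1))"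
  define h where "h a = c \<bullet> a - f a" for a
  have "smooth_on UNIV h"
    unfolding h_def
    by (intro smooth_on_diff f open_UNIV smooth_on_bounded_linear bounded_linear_inner_right)
  moreover have h: "h a + h b = D (a, b) + h (a + b)" for a b
    by (simp add: h_def f(2) inner_add_right)
  moreover have "of_real_circle (h (rvec m)) = 0" for m
  proof (rule additive_zvec_eq_0[where h = "\<lambda>m. of_real_circle (h (rvec m))"])
    fix m m' :: "'n zvec"
    have "of_real_circle (h (rvec m) + h (rvec m')) = d (rvec m, rvec m') + of_real_circle (h (rvec m + rvec m'))"
      by (simp only: h of_real_circle_add D(2))
    then show "of_real_circle (h (rvec (m + m'))) = of_real_circle (h (rvec m)) + of_real_circle (h (rvec m'))"
      by (simp add: int rvec_add of_real_circle_add)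
  next
    show "of_real_circle (h (rvec (axis i 1))) = 0" for i
      by (simp add: h_def rvec_axis c_def inner_axis)
  qed
  ultimately show ?thesis
    by (intro that[of "\<lambda>a. of_real_circle (h a)"])
      (simp_all add: smooth_circle_of_real D(2) flip: of_real_circle_add)
qed


section \<open>Integer matrices as bilinear forms\<close>

lemma rmat_nth [simp]: "rmat M $ r $ c = real_of_int (M $ r $ c)"
  by (simp add: rmat_def)

lemma rmat_mult: "rmat (A ** B) = rmat A ** rmat B"
  by (simp add: vec_eq_iff matrix_matrix_mult_def)

lemma rmat_mult_vec: "rmat (A ** B) *v a = rmat A *v (rmat B *v a)"
  by (simp add: rmat_mult matrix_vector_mul_assoc)

lemma rmat_1 [simp]: "rmat (mat 1 :: 'n::finite zmat) *v a = a"
proof -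
  have "rmat (mat 1 :: 'n zmat) = mat 1" by (simp add: vec_eq_iff mat_def)
  then show ?thesis by simp
qed

lemma rmat_rvec: "rmat A *v rvec m = rvec (A *v m)"
  by (simp add: vec_eq_iff matrix_vector_mult_def)

lemma inner_rvec: "rvec m \<bullet> rvec m' = real_of_int (\<Sum>i\<in>UNIV. m $ i * m' $ i)"
  by (simp add: inner_vec_def)

lemma inner_rmat_transpose: "(rmat (transpose P) *v a) \<bullet> b = a \<bullet> (rmat P *v b)"
proof -
  have "rmat (transpose P) = transpose (rmat P)" by (simp add: vec_eq_iff transpose_def)
  then show ?thesis by (simp add: transpose_matrix_vector dot_lmul_matrix)
qed

definition mform :: "'n::finite zmat \<Rightarrow> 'n rvec \<Rightarrow> 'n rvec \<Rightarrow> real" where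
  "mform M a b = a \<bullet> (rmat M *v b)"

lemma bounded_bilinear_mform: "bounded_bilinear (mform M)"
  unfolding mform_def
  by (rule bounded_bilinear.comp[OF bounded_bilinear_inner bounded_linear_ident matrix_vector_mul_bounded_linear])

lemmas mform_bilinear =
  bounded_bilinear.add_left[OF bounded_bilinear_mform] bounded_bilinear.add_right[OF bounded_bilinear_mform]
  bounded_bilinear.zero_left[OF bounded_bilinear_mform] bounded_bilinear.zero_right[OF bounded_bilinear_mform]

lemma mform_axis: "mform M (axis i 1) (axis j 1) = real_of_int (M $ i $ j)"
  by (simp add: mform_def inner_axis' matrix_vector_mult_basis column_def)

lemma mform_eqI: "(\<And>a b. mform M a b = mform N a b) \<Longrightarrow> M = N"
  by (metis (no_types, lifting) mform_axis of_int_eq_iff vec_eq_iff)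

lemma mform_congruence: "mform (transpose P ** M ** P) a b = mform M (rmat P *v a) (rmat P *v b)"
proof -
  have "mform (transpose P ** M ** P) a b = (rmat (transpose (transpose P)) *v a) \<bullet> (rmat M *v (rmat P *v b))"
    unfolding mform_def by (simp only: rmat_mult_vec inner_rmat_transpose)
  then show ?thesis by (simp add: mform_def)
qed

lemma mform_transpose: "mform (transpose M) a b = mform M b a"
  unfolding mform_def by (metis inner_commute inner_rmat_transpose)

lemma mform_diff: "mform (M - N) a b = mform M a b - mform N a b"
proof -
  have "rmat (M - N) = rmat M - rmat N" by (simp add: vec_eq_iff)
  then show ?thesis by (simp add: mform_def matrix_vector_mult_diff_rdistrib inner_diff_right)
qed

lemma mform_scale: "mform (map_matrix ((*) e) M) a b = real_of_int e * mform M a b"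
proof -
  have "rmat (map_matrix ((*) e) M) = real_of_int e *\<^sub>R rmat M" by (simp add: vec_eq_iff)
  then show ?thesis by (simp add: mform_def scaleR_matrix_vector_assoc[symmetric])
qed

lemma mform_0 [simp]: "mform 0 a b = 0"
  using mform_scale[of 0 0 a b] by (simp add: map_matrix_def vec_eq_iff zero_vec_def)

lemma mform_uminus: "mform (- M) a b = - mform M a b"
  using mform_diff[of 0 M a b] by simp

lemma mform_rvec: "mform M (rvec m) (rvec m') \<in> \<int>"
  unfolding mform_def rmat_rvec inner_rvec by (rule Ints_of_int)


section \<open>The split orthogonal group\<close>

text \<open>In terms of bilinear forms the products of integer matrices become evaluations at real vectors, which
  is the form in which the matrices enter the objects of the 2-group.\<close>

lemma mem_Opm_iff:
  "A \<in> carrier Opm \<longleftrightarrow> invertible A \<and>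
     (\<exists>e\<in>{1, - 1 :: int}. \<forall>a b. mform Imat (rmat A *v a) (rmat A *v b) = real_of_int e * mform Imat a b)"
proof -
  have pos: "transpose A ** Imat ** A = Imat \<longleftrightarrow> (\<forall>a b. mform Imat (rmat A *v a) (rmat A *v b) = mform Imat a b)"
    by (metis mform_congruence mform_eqI)
  have neg: "transpose A ** Imat ** A = - Imat \<longleftrightarrow> (\<forall>a b. mform Imat (rmat A *v a) (rmat A *v b) = - mform Imat a b)"
    by (metis mform_congruence mform_eqI mform_uminus)
  show ?thesis
    by (simp add: Opm_def pos neg)
qed

lemma Imat_nonzero: "\<exists>u v. mform (Imat :: 'n::finite zmat) u v = 1"
proof -
  have "mform (Imat :: 'n zmat) (axis (Inl k) 1) (axis (Inr k) 1) = 1" for k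
    by (simp add: mform_axis Imat_def)
  then show ?thesis by blast
qed

lemma isosign_eqI:
  assumes "\<And>a b. mform Imat (rmat A *v a) (rmat A *v b) = real_of_int e * mform Imat a b"
  shows "isosign A = e"
  unfolding isosign_def
proof (rule the_equality)
  show "transpose A ** Imat ** A = map_matrix ((*) e) Imat"
    by (rule mform_eqI) (simp add: mform_congruence mform_scale assms)
next
  fix e' assume e': "transpose A ** Imat ** A = map_matrix ((*) e') Imat"
  obtain u v where "mform (Imat :: 'a zmat) u v = 1" using Imat_nonzero by blast
  moreover have "mform (transpose A ** Imat ** A) u v = e * mform Imat u v"
    by (simp add: mform_congruence assms)
  ultimately show "e' = e"
    by (simp add: e' mform_scale)
qed

lemma Opm_isosign:
  assumes "A \<in> carrier Opm"
  shows "isosign A = 1 \<or> isosign A = - 1"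
    and "mform Imat (rmat A *v a) (rmat A *v b) = isosign A * mform Imat a b"
proof -
  obtain e where e: "e \<in> {1, - 1 :: int}"
    "\<And>a b. mform Imat (rmat A *v a) (rmat A *v b) = real_of_int e * mform Imat a b"
    using assms unfolding mem_Opm_iff by blast
  with isosign_eqI[of A e, OF e(2)] show "isosign A = 1 \<or> isosign A = - 1"
    and "mform Imat (rmat A *v a) (rmat A *v b) = isosign A * mform Imat a b"
    by simp_all
qed

lemma Opm_mult_closed:
  assumes A: "A \<in> carrier Opm" and B: "B \<in> carrier Opm"
  shows "A ** B \<in> carrier Opm" and "isosign (A ** B) = isosign A * isosign B"
proof -
  have *: "mform Imat (rmat (A ** B) *v a) (rmat (A ** B) *v b) = real_of_int (isosign A * isosign B) * mform Imat a b"
    for a b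
    by (simp add: rmat_mult_vec Opm_isosign(2) assms)
  then show "isosign (A ** B) = isosign A * isosign B" by (rule isosign_eqI)
  have "invertible (A ** B)" using assms by (simp add: mem_Opm_iff invertible_mult)
  moreover have "isosign A * isosign B \<in> {1, - 1}"
    using Opm_isosign(1)[OF A] Opm_isosign(1)[OF B] by auto
  ultimately show "A ** B \<in> carrier Opm"
    unfolding mem_Opm_iff using * by blast
qed

lemma isosign_1 [simp]: "isosign (mat 1) = 1"
  by (rule isosign_eqI) simp

lemma Opm_1: "mat 1 \<in> carrier Opm"
  unfolding mem_Opm_iff by (auto simp: invertible_def intro!: exI[of _ "mat 1"])

lemma Opm_inverse:
  assumes A: "A \<in> carrier Opm"
  shows "A ** matrix_inv A = mat 1" "matrix_inv A ** A = mat 1"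
    and "matrix_inv A \<in> carrier Opm" "isosign (matrix_inv A) = isosign A"
proof -
  have "\<exists>A'. A ** A' = mat 1 \<and> A' ** A = mat 1"
    using A by (simp add: mem_Opm_iff invertible_def)
  then have inv: "A ** matrix_inv A = mat 1 \<and> matrix_inv A ** A = mat 1"
    unfolding matrix_inv_def by (rule someI_ex)
  then show "A ** matrix_inv A = mat 1" "matrix_inv A ** A = mat 1" by auto
  have *: "mform Imat (rmat (matrix_inv A) *v a) (rmat (matrix_inv A) *v b) = isosign A * mform Imat a b" for a b
  proof -
    have "mform Imat a b = isosign A * mform Imat (rmat (matrix_inv A) *v a) (rmat (matrix_inv A) *v b)"
      using Opm_isosign(2)[OF A, of "rmat (matrix_inv A) *v a" "rmat (matrix_inv A) *v b"] inv
      by (simp flip: rmat_mult_vec)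
    then show ?thesis using Opm_isosign(1)[OF A] by auto
  qed
  then show "isosign (matrix_inv A) = isosign A" by (rule isosign_eqI)
  show "matrix_inv A \<in> carrier Opm"
    unfolding mem_Opm_iff using * inv Opm_isosign(1)[OF A] by (auto simp: invertible_def)
qed

lemma Opm_mult [simp]: "A \<otimes>\<^bsub>Opm\<^esub> B = A ** B" and Opm_one [simp]: "\<one>\<^bsub>Opm\<^esub> = mat 1"
  by (simp_all add: Opm_def)

lemma group_Opm: "group Opm"
proof (rule groupI)
  show "\<exists>B\<in>carrier Opm. B \<otimes>\<^bsub>Opm\<^esub> A = \<one>\<^bsub>Opm\<^esub>" if "A \<in> carrier Opm" for A
    using Opm_inverse[OF that] by auto
qed (simp_all add: Opm_mult_closed Opm_1 matrix_mul_assoc)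

lemma Opm_inverse_vec:
  assumes "A \<in> carrier Opm"
  shows "rmat A *v (rmat (matrix_inv A) *v a) = a" "rmat (matrix_inv A) *v (rmat A *v a) = a"
  using Opm_inverse[OF assms] by (simp_all flip: rmat_mult_vec)

text \<open>The action is dual to the defining representation up to the sign: \<open>A\<^sup>t\<^sup>rIA = iso(A)I\<close> gives
  \<open>(IAI)\<^sup>t\<^sup>rA = iso(A)E\<close>. This is why a character pulled back along \<open>A\<^sup>-\<^sup>1\<close> and multiplied with the sign is
  given by the action.\<close>

lemma Opm_act_inner:
  assumes "A \<in> carrier Opm"
  shows "rvec (Opm_act A m) \<bullet> (rmat A *v a) = isosign A * (rvec m \<bullet> a)"
proof -
  have UNIV_split: "sum f UNIV = (\<Sum>k\<in>UNIV. f (Inl k)) + (\<Sum>k\<in>UNIV. f (Inr k))" for f :: "'a + 'a \<Rightarrow> int"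
    by (simp add: sum.Plus flip: UNIV_Plus_UNIV)
  have "(Imat ** Imat) $ i $ j = (mat 1 :: 'a zmat) $ i $ j" for i j
    by (cases i; cases j)
      (simp_all add: Imat_def matrix_matrix_mult_def mat_def UNIV_split if_distrib[of "\<lambda>x. x * _"] cong: if_cong)
  then have I: "transpose Imat = (Imat :: 'a zmat)" "Imat ** Imat = (mat 1 :: 'a zmat)"
    by (auto simp: vec_eq_iff transpose_def Imat_def split: sum.splits)
  have II: "rmat Imat *v (rmat Imat *v x) = x" for x :: "'a rvec"
    using I(2) by (simp flip: rmat_mult_vec)
  have It: "(rmat Imat *v x) \<bullet> y = mform Imat x y" for x y :: "'a rvec"
    using inner_rmat_transpose[of Imat x y] by (simp add: I mform_def)
  have "rvec (Opm_act A m) = rmat Imat *v (rmat A *v (rmat Imat *v rvec m))"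
    by (simp add: Opm_act_def rmat_rvec matrix_vector_mul_assoc matrix_mul_assoc)
  then have "rvec (Opm_act A m) \<bullet> (rmat A *v a) = isosign A * ((rmat Imat *v (rmat Imat *v rvec m)) \<bullet> a)"
    by (simp only: It Opm_isosign(2)[OF assms])
  then show ?thesis by (simp add: II)
qed

lemma Opm_act_add: "Opm_act A (m + m') = Opm_act A m + Opm_act A m'"
  by (simp add: Opm_act_def matrix_vector_right_distrib)

lemma mform_Bmat:
  "mform (Bmat A) a b = isosign A * mform Jmat a b - mform Jmat (rmat A *v a) (rmat A *v b)"
  by (simp add: Bmat_def mform_diff mform_scale mform_congruence)

text \<open>\<open>\<B>\<close> is itself a 1-cocycle, which is why the symmetry defects of two objects combine in a product.\<close>

lemma mform_Bmat_mult:
  assumes "A \<in> carrier Opm" "B \<in> carrier Opm"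
  shows "mform (Bmat (A ** B)) a b = mform (Bmat A) (rmat B *v a) (rmat B *v b) + isosign A * mform (Bmat B) a b"
  using assms by (simp add: mform_Bmat Opm_mult_closed rmat_mult_vec algebra_simps)

lemma Bmat_1: "Bmat (mat 1) = 0"
  by (rule mform_eqI) (simp add: mform_Bmat)

lemma mform_Imat: "mform Imat a b = mform Jmat a b + mform Jmat b a"
proof -
  have "rmat Imat = rmat Jmat + rmat (transpose (Jmat :: 'a zmat))"
    by (auto simp: vec_eq_iff Imat_def Jmat_def transpose_def split: sum.splits)
  then have "mform Imat a b = mform Jmat a b + mform (transpose Jmat) a b" 
    by (simp add: mform_def matrix_vector_mult_add_rdistrib inner_add_right)
  then show ?thesis by (simp add: mform_transpose)
qed

lemma mform_Bmat_skew:
  assumes "A \<in> carrier Opm"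
  shows "mform (Bmat A) a b = - mform (Bmat A) b a"
proof -
  have "mform (Bmat A) a b + mform (Bmat A) b a
      = isosign A * mform Imat a b - mform Imat (rmat A *v a) (rmat A *v b)"
    by (simp add: mform_Bmat mform_Imat algebra_simps)
  then show ?thesis by (simp add: Opm_isosign(2)[OF assms])
qed


section \<open>The strict model as a 2-group\<close>

lemma smooth_cocycle2_0: "smooth_cocycle2 (\<lambda>_. 0)"
  by (simp add: smooth_cocycle2_def)

lemma smooth_cocycle2_add:
  assumes "smooth_cocycle2 \<eta>" "smooth_cocycle2 \<eta>'"
  shows "smooth_cocycle2 (\<lambda>p. \<eta> p + \<eta>' p)"
proof -
  have "\<eta> (a, b) + \<eta>' (a, b) + (\<eta> (a + b, c) + \<eta>' (a + b, c))
      = \<eta> (b, c) + \<eta>' (b, c) + (\<eta> (a, b + c) + \<eta>' (a, b + c))" for a b c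
  proof -
    have "\<eta> (a, b) + \<eta> (a + b, c) + (\<eta>' (a, b) + \<eta>' (a + b, c))
        = \<eta> (b, c) + \<eta> (a, b + c) + (\<eta>' (b, c) + \<eta>' (a, b + c))"
      using assms by (simp only: smooth_cocycle2_def)
    then show ?thesis by (simp only: ac_simps)
  qed
  then show ?thesis
    using assms by (simp add: smooth_cocycle2_def smooth_circle_add)
qed

lemma smooth_cocycle2_zscale:
  assumes "smooth_cocycle2 \<eta>"
  shows "smooth_cocycle2 (\<lambda>p. zscale k (\<eta> p))"
  using assms by (simp add: smooth_cocycle2_def smooth_circle_zscale flip: zscale_add)

lemma smooth_cocycle2_diff:
  assumes "smooth_cocycle2 \<eta>" "smooth_cocycle2 \<eta>'"
  shows "smooth_cocycle2 (\<lambda>p. \<eta> p - \<eta>' p)"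
  using smooth_cocycle2_add[OF assms(1) smooth_cocycle2_zscale[OF assms(2), of "- 1"]]
  by (simp add: zscale_uminus)

lemma smooth_cocycle2_compose:
  assumes "smooth_cocycle2 \<eta>"
  shows "smooth_cocycle2 (\<lambda>(a, b). \<eta> (rmat A *v a, rmat A *v b))"
proof -
  have "bounded_linear (\<lambda>p. (rmat A *v fst p, rmat A *v snd p))"
    by (intro bounded_linear_Pair bounded_linear_compose[OF matrix_vector_mul_bounded_linear]
        bounded_linear_fst bounded_linear_snd)
  with assms smooth_circle_compose_linear
  have "smooth_circle (\<lambda>p. \<eta> (rmat A *v fst p, rmat A *v snd p))"
    unfolding smooth_cocycle2_def by blast
  then have "smooth_circle (\<lambda>(a, b). \<eta> (rmat A *v a, rmat A *v b))"
    by (simp add: case_prod_beta')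
  then show ?thesis
    using assms by (simp add: smooth_cocycle2_def matrix_vector_right_distrib)
qed

text \<open>The two forms \<open>J\<close> in the definition of an object combine to \<open>\<B>(A)\<close>.\<close>

lemma is_aobj_iff:
  "is_aobj x \<longleftrightarrow> fst x \<in> carrier Opm \<and> smooth_cocycle2 (snd x) \<and>
     (\<forall>m m'. snd x (rvec m, rvec m') = 0) \<and>
     (\<forall>m a. snd x (rvec m, a) + of_real_circle (mform (Bmat (fst x)) a (rvec m)) = snd x (a, rvec m))"
proof (cases x)
  case (Pair A \<eta>)
  have swap: "\<eta> (rvec m, a) + zscale (isosign A) (of_real_circle (a \<bullet> (rmat Jmat *v rvec m)))
        = \<eta> (a, rvec m) + of_real_circle ((rmat A *v a) \<bullet> (rmat Jmat *v (rmat A *v rvec m)))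
      \<longleftrightarrow> \<eta> (rvec m, a) + of_real_circle (mform (Bmat A) a (rvec m)) = \<eta> (a, rvec m)" for m a
  proof -
    have B: "mform (Bmat A) a (rvec m) = isosign A * (a \<bullet> (rmat Jmat *v rvec m))
        - (rmat A *v a) \<bullet> (rmat Jmat *v (rmat A *v rvec m))"
      unfolding mform_Bmat by (simp only: mform_def)
    show ?thesis
      unfolding B by (auto simp: zscale_of_real of_real_circle_diff algebra_simps)
  qed
  show ?thesis
    unfolding Pair is_aobj_def by (simp add: swap)
qed

lemma is_amor_iff:
  "is_amor (x, \<beta>, y) \<longleftrightarrow> is_aobj x \<and> is_aobj y \<and> fst x = fst y \<and> smooth_circle \<beta> \<and>
     (\<forall>m. \<beta> (rvec m) = 0) \<and> (\<forall>a b. \<beta> a + \<beta> b + snd x (a, b) = snd y (a, b) + \<beta> (a + b))"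
  by (cases x; cases y) (auto simp: is_amor_def)

lemma fst_amult [simp]: "fst (amult x y) = fst x ** fst y"
  by (simp add: amult_def case_prod_beta)

lemma snd_amult [simp]:
  "snd (amult x y) (a, b) = snd x (rmat (fst y) *v a, rmat (fst y) *v b) + zscale (isosign (fst x)) (snd y (a, b))"
  by (simp add: amult_def case_prod_beta)

definition ainv :: "'n::finite aobj \<Rightarrow> 'n aobj" where
  "ainv x = (matrix_inv (fst x), \<lambda>(a, b). zscale (- isosign (fst x))
     (snd x (rmat (matrix_inv (fst x)) *v a, rmat (matrix_inv (fst x)) *v b)))"

lemma fst_ainv [simp]: "fst (ainv x) = matrix_inv (fst x)"
  by (simp add: ainv_def)

lemma snd_ainv [simp]:
  "snd (ainv x) (a, b) = zscale (- isosign (fst x))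
     (snd x (rmat (matrix_inv (fst x)) *v a, rmat (matrix_inv (fst x)) *v b))"
  by (simp add: ainv_def)

lemma is_aobj_one: "is_aobj (mat 1, \<lambda>_. 0)"
  by (simp add: is_aobj_iff Opm_1 smooth_cocycle2_0 Bmat_1)

lemma is_aobj_amult:
  assumes x: "is_aobj x" and y: "is_aobj y"
  shows "is_aobj (amult x y)"
proof -
  let ?A = "fst x" and ?B = "fst y"
  have AB: "?A \<in> carrier Opm" "?B \<in> carrier Opm" using assms by (simp_all add: is_aobj_iff)
  have "smooth_cocycle2 (\<lambda>p. (\<lambda>(a, b). snd x (rmat ?B *v a, rmat ?B *v b)) p + zscale (isosign ?A) (snd y p))"
    by (intro smooth_cocycle2_add smooth_cocycle2_compose smooth_cocycle2_zscale)
      (use assms in \<open>simp_all add: is_aobj_iff\<close>)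
  moreover have "snd (amult x y) = (\<lambda>p. (\<lambda>(a, b). snd x (rmat ?B *v a, rmat ?B *v b)) p + zscale (isosign ?A) (snd y p))"
    by (auto simp: fun_eq_iff)
  ultimately have "smooth_cocycle2 (snd (amult x y))" by simp
  moreover have "snd (amult x y) (rvec m, a) + of_real_circle (mform (Bmat (?A ** ?B)) a (rvec m))
      = snd (amult x y) (a, rvec m)" for m a
  proof -
    have "snd x (rvec (?B *v m), rmat ?B *v a) + of_real_circle (mform (Bmat ?A) (rmat ?B *v a) (rvec (?B *v m)))
        = snd x (rmat ?B *v a, rvec (?B *v m))"
      using x by (simp add: is_aobj_iff)
    moreover have "snd y (rvec m, a) + of_real_circle (mform (Bmat ?B) a (rvec m)) = snd y (a, rvec m)"
      using y by (simp add: is_aobj_iff)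
    ultimately show ?thesis
      by (simp add: mform_Bmat_mult[OF AB] rmat_rvec of_real_circle_add zscale_add add_ac
          flip: zscale_of_real)
        (simp only: add.assoc[symmetric] zscale_add[symmetric])
  qed
  moreover have "snd (amult x y) (rvec m, rvec m') = 0" for m m'
    using assms by (simp add: is_aobj_iff rmat_rvec)
  ultimately show ?thesis
    using AB by (simp add: is_aobj_iff[of "amult x y"] Opm_mult_closed)
qed

lemma is_aobj_ainv:
  assumes x: "is_aobj x"
  shows "is_aobj (ainv x)"
proof -
  let ?A = "fst x" and ?A' = "matrix_inv (fst x)"
  have A: "?A \<in> carrier Opm" using assms by (simp add: is_aobj_iff)
  note A' = Opm_inverse[OF A]
  have "smooth_cocycle2 (\<lambda>p. zscale (- isosign ?A) ((\<lambda>(a, b). snd x (rmat ?A' *v a, rmat ?A' *v b)) p))"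
    by (intro smooth_cocycle2_compose smooth_cocycle2_zscale)
      (use assms in \<open>simp_all add: is_aobj_iff\<close>)
  moreover have "snd (ainv x) = (\<lambda>p. zscale (- isosign ?A) ((\<lambda>(a, b). snd x (rmat ?A' *v a, rmat ?A' *v b)) p))"
    by (auto simp: fun_eq_iff)
  ultimately have "smooth_cocycle2 (snd (ainv x))" by simp
  moreover have "snd (ainv x) (rvec m, a) + of_real_circle (mform (Bmat ?A') a (rvec m))
      = snd (ainv x) (a, rvec m)" for m a
  proof -
    have "mform (Bmat ?A) (rmat ?A' *v a) (rmat ?A' *v rvec m) + isosign ?A * mform (Bmat ?A') a (rvec m) = 0"
      using mform_Bmat_mult[OF A A'(3), of a "rvec m"] by (simp add: A' Bmat_1)
    then have "mform (Bmat ?A') a (rvec m) = real_of_int (- isosign ?A) * mform (Bmat ?A) (rmat ?A' *v a) (rmat ?A' *v rvec m)"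
      using Opm_isosign(1)[OF A] by auto
    then have "snd (ainv x) (rvec m, a) + of_real_circle (mform (Bmat ?A') a (rvec m))
        = zscale (- isosign ?A) (snd x (rvec (?A' *v m), rmat ?A' *v a)
            + of_real_circle (mform (Bmat ?A) (rmat ?A' *v a) (rvec (?A' *v m))))"
      by (simp only: snd_ainv zscale_of_real[symmetric] zscale_add rmat_rvec)
    also have "\<dots> = snd (ainv x) (a, rvec m)"
      using x by (simp add: is_aobj_iff rmat_rvec)
    finally show ?thesis .
  qed
  moreover have "snd (ainv x) (rvec m, rvec m') = 0" for m m'
    using assms by (simp add: is_aobj_iff rmat_rvec)
  ultimately show ?thesis
    using A' by (simp add: is_aobj_iff[of "ainv x"])
qed

lemma aobj_eqI: "fst x = fst y \<Longrightarrow> (\<And>a b. snd x (a, b) = snd y (a, b)) \<Longrightarrow> x = (y :: 'n::finite aobj)"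
  by (simp add: prod_eq_iff fun_eq_iff)

lemma amult_assoc:
  assumes "is_aobj x" "is_aobj y"
  shows "amult (amult x y) z = amult x (amult y z)"
  using assms
  by (intro aobj_eqI) (simp_all add: is_aobj_iff Opm_mult_closed matrix_mul_assoc rmat_mult_vec zscale_add zscale_zscale add_ac)

lemma amult_one: "amult (mat 1, \<lambda>_. 0) x = x" "amult x (mat 1, \<lambda>_. 0) = x"
  by (intro aobj_eqI; simp)+

lemma amult_ainv: "is_aobj x \<Longrightarrow> amult (ainv x) x = (mat 1, \<lambda>_. 0)"
  by (intro aobj_eqI) (simp_all add: is_aobj_iff Opm_inverse Opm_inverse_vec zscale_uminus)

lemma strict_AUT_TD_simps [simp]:
  "carrier (Obj strict_AUT_TD) = {x. is_aobj x}"
  "x \<otimes>\<^bsub>Obj strict_AUT_TD\<^esub> y = amult x y"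
  "\<one>\<^bsub>Obj strict_AUT_TD\<^esub> = (mat 1, \<lambda>_. 0)"
  "carrier (Mor strict_AUT_TD) = {f. is_amor f}"
  "(x, \<beta>, y) \<otimes>\<^bsub>Mor strict_AUT_TD\<^esub> (x', \<beta>', y') =
     (amult x x', \<lambda>a. \<beta> (rmat (fst x') *v a) + zscale (isosign (fst x)) (\<beta>' a), amult y y')"
  "\<one>\<^bsub>Mor strict_AUT_TD\<^esub> = ((mat 1, \<lambda>_. 0), \<lambda>_. 0, (mat 1, \<lambda>_. 0))"
  "src strict_AUT_TD (x, \<beta>, y) = x"
  "tgt strict_AUT_TD (x, \<beta>, y) = y"
  "idm strict_AUT_TD x = (x, \<lambda>_. 0, x)"
  "vcomp strict_AUT_TD (x', \<beta>', y') (x, \<beta>, y) = (x, \<lambda>a. \<beta>' a + \<beta> a, y')"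
  by (simp_all add: strict_AUT_TD_def)

lemma group_Obj: "group (Obj strict_AUT_TD)"
proof (rule groupI)
  show "\<exists>y\<in>carrier (Obj strict_AUT_TD). y \<otimes>\<^bsub>Obj strict_AUT_TD\<^esub> x = \<one>\<^bsub>Obj strict_AUT_TD\<^esub>"
    if "x \<in> carrier (Obj strict_AUT_TD)" for x
    using that by (intro bexI[of _ "ainv x"]) (simp_all add: amult_ainv is_aobj_ainv)
qed (simp_all add: is_aobj_one is_aobj_amult amult_assoc amult_one)

lemma is_amor_idm: "is_aobj x \<Longrightarrow> is_amor (x, \<lambda>_. 0, x)"
  by (simp add: is_amor_iff)

lemma is_amor_mult:
  assumes f: "is_amor (x, \<beta>, y)" and f': "is_amor (x', \<beta>', y')"
  shows "is_amor (amult x x', \<lambda>a. \<beta> (rmat (fst x') *v a) + zscale (isosign (fst x)) (\<beta>' a), amult y y')"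
proof -
  let ?\<gamma> = "\<lambda>a. \<beta> (rmat (fst x') *v a) + zscale (isosign (fst x)) (\<beta>' a)"
  have eqs: "fst x = fst y" "fst x' = fst y'" using assms by (simp_all add: is_amor_iff)
  have "smooth_circle ?\<gamma>"
    using assms by (intro smooth_circle_add smooth_circle_zscale
        smooth_circle_compose_linear[OF _ matrix_vector_mul_bounded_linear]) (simp_all add: is_amor_iff)
  moreover have "?\<gamma> a + ?\<gamma> b + snd (amult x x') (a, b) = snd (amult y y') (a, b) + ?\<gamma> (a + b)" for a b
  proof -
    let ?a = "rmat (fst x') *v a" and ?b = "rmat (fst x') *v b"
    have 1: "\<beta> ?a + \<beta> ?b + snd x (?a, ?b) = snd y (?a, ?b) + \<beta> (rmat (fst x') *v (a + b))"
      using f by (simp add: is_amor_iff matrix_vector_right_distrib)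
    have 2: "\<beta>' a + \<beta>' b + snd x' (a, b) = snd y' (a, b) + \<beta>' (a + b)"
      using f' by (simp add: is_amor_iff)
    have "?\<gamma> a + ?\<gamma> b + snd (amult x x') (a, b)
        = (\<beta> ?a + \<beta> ?b + snd x (?a, ?b)) + zscale (isosign (fst x)) (\<beta>' a + \<beta>' b + snd x' (a, b))"
      by (simp add: zscale_add add_ac)
    also have "\<dots> = snd (amult y y') (a, b) + ?\<gamma> (a + b)"
      unfolding 1 2 by (simp add: zscale_add add_ac flip: eqs)
    finally show ?thesis .
  qed
  moreover have "?\<gamma> (rvec m) = 0" for m
    using assms by (simp add: is_amor_iff rmat_rvec)
  moreover have "is_aobj (amult x x')" "is_aobj (amult y y')"
    using assms by (simp_all add: is_amor_iff is_aobj_amult)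
  ultimately show ?thesis
    unfolding is_amor_iff by (simp add: eqs)
qed

lemma is_amor_inverse:
  assumes f: "is_amor (x, \<beta>, y)"
  shows "is_amor (ainv x, \<lambda>a. zscale (- isosign (fst x)) (\<beta> (rmat (matrix_inv (fst x)) *v a)), ainv y)"
proof -
  let ?\<gamma> = "\<lambda>a. zscale (- isosign (fst x)) (\<beta> (rmat (matrix_inv (fst x)) *v a))"
  have eqs: "fst x = fst y" using assms by (simp add: is_amor_iff)
  have "smooth_circle ?\<gamma>"
    using assms by (intro smooth_circle_zscale
        smooth_circle_compose_linear[OF _ matrix_vector_mul_bounded_linear]) (simp_all add: is_amor_iff)
  moreover have "?\<gamma> a + ?\<gamma> b + snd (ainv x) (a, b) = snd (ainv y) (a, b) + ?\<gamma> (a + b)" for a b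
  proof -
    let ?a = "rmat (matrix_inv (fst x)) *v a" and ?b = "rmat (matrix_inv (fst x)) *v b"
    have "\<beta> ?a + \<beta> ?b + snd x (?a, ?b) = snd y (?a, ?b) + \<beta> (?a + ?b)"
      using f by (simp add: is_amor_iff)
    then show ?thesis
      by (simp add: matrix_vector_right_distrib eqs flip: zscale_add)
  qed
  moreover have "?\<gamma> (rvec m) = 0" for m
    using assms by (simp add: is_amor_iff rmat_rvec)
  moreover have "is_aobj (ainv x)" "is_aobj (ainv y)"
    using assms by (simp_all add: is_amor_iff is_aobj_ainv)
  ultimately show ?thesis
    unfolding is_amor_iff by (simp add: eqs)
qed

lemma group_Mor: "group (Mor (strict_AUT_TD :: ('n::finite aobj, 'n amor) two_group_data))"
proof (rule groupI)
  fix f g :: "'n amor"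
  assume "f \<in> carrier (Mor strict_AUT_TD)" "g \<in> carrier (Mor strict_AUT_TD)"
  then show "f \<otimes>\<^bsub>Mor strict_AUT_TD\<^esub> g \<in> carrier (Mor strict_AUT_TD)"
    by (cases f rule: prod_cases3; cases g rule: prod_cases3) (simp add: is_amor_mult)
next
  show "\<one>\<^bsub>Mor strict_AUT_TD\<^esub> \<in> carrier (Mor (strict_AUT_TD :: ('n aobj, 'n amor) two_group_data))"
    by (simp add: is_amor_idm is_aobj_one)
next
  fix f g h :: "'n amor"
  assume "f \<in> carrier (Mor strict_AUT_TD)" "g \<in> carrier (Mor strict_AUT_TD)" "h \<in> carrier (Mor strict_AUT_TD)"
  then show "f \<otimes>\<^bsub>Mor strict_AUT_TD\<^esub> g \<otimes>\<^bsub>Mor strict_AUT_TD\<^esub> h = f \<otimes>\<^bsub>Mor strict_AUT_TD\<^esub> (g \<otimes>\<^bsub>Mor strict_AUT_TD\<^esub> h)"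
    by (cases f rule: prod_cases3; cases g rule: prod_cases3; cases h rule: prod_cases3)
      (simp add: is_amor_iff amult_assoc is_aobj_iff Opm_mult_closed rmat_mult_vec zscale_add zscale_zscale add.assoc)
next
  fix f :: "'n amor"
  assume f: "f \<in> carrier (Mor strict_AUT_TD)"
  obtain x \<beta> y where xy: "f = (x, \<beta>, y)" by (rule prod_cases3)
  show "\<one>\<^bsub>Mor strict_AUT_TD\<^esub> \<otimes>\<^bsub>Mor strict_AUT_TD\<^esub> f = f"
    by (simp add: xy amult_one)
  let ?g = "(ainv x, \<lambda>a. zscale (- isosign (fst x)) (\<beta> (rmat (matrix_inv (fst x)) *v a)), ainv y)"
  have xy': "is_aobj x" "is_aobj y"
    using f by (simp_all add: xy is_amor_iff)
  then have "fst x \<in> carrier Opm" by (simp add: is_aobj_iff)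
  have "?g \<otimes>\<^bsub>Mor strict_AUT_TD\<^esub> f = \<one>\<^bsub>Mor strict_AUT_TD\<^esub>"
    using xy' \<open>fst x \<in> carrier Opm\<close> by (simp add: xy amult_ainv Opm_inverse Opm_inverse_vec zscale_uminus)
  moreover have "?g \<in> carrier (Mor strict_AUT_TD)"
    using f by (simp add: xy is_amor_inverse)
  ultimately show "\<exists>g\<in>carrier (Mor strict_AUT_TD). g \<otimes>\<^bsub>Mor strict_AUT_TD\<^esub> f = \<one>\<^bsub>Mor strict_AUT_TD\<^esub>"
    by blast
qed

lemma is_amor_vcomp:
  assumes "is_amor (x, \<beta>, y)" "is_amor (y, \<beta>', z)"
  shows "is_amor (x, \<lambda>a. \<beta>' a + \<beta> a, z)"
proof -
  have "\<beta>' a + \<beta> a + (\<beta>' b + \<beta> b) + snd x (a, b) = snd z (a, b) + (\<beta>' (a + b) + \<beta> (a + b))" for a b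
  proof -
    have 1: "\<beta> a + \<beta> b + snd x (a, b) = snd y (a, b) + \<beta> (a + b)"
      and 2: "\<beta>' a + \<beta>' b + snd y (a, b) = snd z (a, b) + \<beta>' (a + b)"
      using assms by (simp_all add: is_amor_iff)
    have "\<beta>' a + \<beta> a + (\<beta>' b + \<beta> b) + snd x (a, b) = \<beta>' a + \<beta>' b + (\<beta> a + \<beta> b + snd x (a, b))"
      by (simp add: add_ac)
    also have "\<dots> = \<beta>' a + \<beta>' b + snd y (a, b) + \<beta> (a + b)"
      unfolding 1 by (simp add: add_ac)
    also have "\<dots> = snd z (a, b) + (\<beta>' (a + b) + \<beta> (a + b))"
      unfolding 2 by (simp add: add_ac)
    finally show ?thesis .
  qed
  then show ?thesis using assms by (simp add: is_amor_iff smooth_circle_add)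
qed

lemma strict_two_group_AUT_TD:
  "strict_two_group (strict_AUT_TD :: ('n::finite aobj, 'n amor) two_group_data)"
  (is "strict_two_group ?\<Gamma>")
proof (rule strict_two_group.intro)
  show "group (Obj ?\<Gamma>)" by (rule group_Obj)
  show "group (Mor ?\<Gamma>)" by (rule group_Mor)
  show "src ?\<Gamma> \<in> hom (Mor ?\<Gamma>) (Obj ?\<Gamma>)" "tgt ?\<Gamma> \<in> hom (Mor ?\<Gamma>) (Obj ?\<Gamma>)"
    by (auto simp: hom_def is_amor_iff simp del: split_paired_All)
  show "idm ?\<Gamma> \<in> hom (Obj ?\<Gamma>) (Mor ?\<Gamma>)"
    by (simp add: hom_def is_amor_idm)
next
  fix f f' :: "'n amor"
  assume "f \<in> carrier (Mor ?\<Gamma>)" "f' \<in> carrier (Mor ?\<Gamma>)" "tgt ?\<Gamma> f = src ?\<Gamma> f'"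
  then show "vcomp ?\<Gamma> f' f \<in> carrier (Mor ?\<Gamma>)" "src ?\<Gamma> (vcomp ?\<Gamma> f' f) = src ?\<Gamma> f"
    "tgt ?\<Gamma> (vcomp ?\<Gamma> f' f) = tgt ?\<Gamma> f'"
    by (cases f rule: prod_cases3; cases f' rule: prod_cases3; simp add: is_amor_vcomp)+
next
  fix f f' f'' :: "'n amor"
  show "vcomp ?\<Gamma> f'' (vcomp ?\<Gamma> f' f) = vcomp ?\<Gamma> (vcomp ?\<Gamma> f'' f') f"
    by (cases f rule: prod_cases3; cases f' rule: prod_cases3; cases f'' rule: prod_cases3)
      (simp add: add_ac)
next
  fix f :: "'n amor"
  show "vcomp ?\<Gamma> f (idm ?\<Gamma> (src ?\<Gamma> f)) = f" "vcomp ?\<Gamma> (idm ?\<Gamma> (tgt ?\<Gamma> f)) f = f"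
    by (cases f rule: prod_cases3; simp)+
next
  fix f1 f1' f2 f2' :: "'n amor"
  assume "f1 \<in> carrier (Mor ?\<Gamma>)" "f1' \<in> carrier (Mor ?\<Gamma>)" "tgt ?\<Gamma> f1 = src ?\<Gamma> f1'"
    "f2 \<in> carrier (Mor ?\<Gamma>)" "f2' \<in> carrier (Mor ?\<Gamma>)" "tgt ?\<Gamma> f2 = src ?\<Gamma> f2'"
  then show "vcomp ?\<Gamma> f1' f1 \<otimes>\<^bsub>Mor ?\<Gamma>\<^esub> vcomp ?\<Gamma> f2' f2
      = vcomp ?\<Gamma> (f1' \<otimes>\<^bsub>Mor ?\<Gamma>\<^esub> f2') (f1 \<otimes>\<^bsub>Mor ?\<Gamma>\<^esub> f2)"
    by (cases f1 rule: prod_cases3; cases f1' rule: prod_cases3; cases f2 rule: prod_cases3; cases f2' rule: prod_cases3)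
      (simp add: is_amor_iff zscale_add add_ac)
qed simp_all


section \<open>Objects over a given matrix\<close>

lemma mform_low_diff:
  assumes A: "A \<in> carrier Opm"
  shows "mform (low (Bmat A)) a b - mform (low (Bmat A)) b a = mform (Bmat A) a b"
proof -
  have "transpose (Bmat A) = - Bmat A"
    by (rule mform_eqI) (metis mform_transpose mform_uminus mform_Bmat_skew[OF A])
  then have "Bmat A = low (Bmat A) - transpose (low (Bmat A))"
    using low_characterization by blast
  then have "mform (Bmat A) a b = mform (low (Bmat A) - transpose (low (Bmat A))) a b"
    by simp
  then show ?thesis by (simp only: mform_diff mform_transpose)
qed

text \<open>The bilinear representative among all cocycles that make \<open>A\<close> an object.\<close>

definition std_obj :: "'n::{finite,linorder} zmat \<Rightarrow> 'n aobj" where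
  "std_obj A = (A, \<lambda>(a, b). of_real_circle (mform (low (Bmat A)) a b))"

lemma std_obj_simps [simp]:
  "fst (std_obj A) = A" "snd (std_obj A) (a, b) = of_real_circle (mform (low (Bmat A)) a b)"
  by (simp_all add: std_obj_def)

lemma is_aobj_std_obj:
  assumes A: "A \<in> carrier Opm"
  shows "is_aobj (std_obj A)"
proof -
  let ?L = "low (Bmat A)"
  have "smooth_on UNIV (\<lambda>p. mform ?L (fst p) (snd p))"
    by (rule smooth_on_quadratic[OF bounded_bilinear.comp[OF bounded_bilinear_mform
            bounded_linear_fst bounded_linear_snd] open_UNIV])
  then have "smooth_circle (snd (std_obj A))"
    using smooth_circle_of_real by (simp add: std_obj_def case_prod_beta')
  then have "smooth_cocycle2 (snd (std_obj A))"
    by (simp add: smooth_cocycle2_def mform_bilinear add_ac flip: of_real_circle_add)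
  moreover have "mform ?L (rvec m) a + mform (Bmat A) a (rvec m) = mform ?L a (rvec m)" for m a
    using mform_low_diff[OF A, of a "rvec m"] by simp
  ultimately show ?thesis
    using A by (simp add: is_aobj_iff of_real_circle_eq_0_iff mform_rvec flip: of_real_circle_add)
qed

text \<open>The two objects violate symmetry by the same form \<open>\<B>(A)\<close>, so their difference is symmetric
  as soon as one argument is integral.\<close>

lemma isomorphic_if_same_matrix:
  assumes x: "is_aobj x" and y: "is_aobj y" and xy: "fst x = fst y"
  obtains \<beta> where "is_amor (x, \<beta>, y)"
proof -
  let ?d = "\<lambda>p. snd y p - snd x p"
  have "smooth_cocycle2 ?d"
    using x y by (intro smooth_cocycle2_diff) (simp_all add: is_aobj_iff)
  moreover have "?d (rvec m, rvec m') = 0" for m m'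
    using x y by (simp add: is_aobj_iff)
  moreover have "?d (rvec m, a) = ?d (a, rvec m)" for m a
  proof -
    have "snd x (rvec m, a) + of_real_circle (mform (Bmat (fst x)) a (rvec m)) = snd x (a, rvec m)"
      "snd y (rvec m, a) + of_real_circle (mform (Bmat (fst x)) a (rvec m)) = snd y (a, rvec m)"
      using x y xy by (simp_all add: is_aobj_iff)
    then show ?thesis by (metis add_diff_cancel_right)
  qed
  ultimately obtain \<beta> where \<beta>: "smooth_circle \<beta>" "\<And>m. \<beta> (rvec m) = 0"
    "\<And>a b. \<beta> a + \<beta> b = ?d (a, b) + \<beta> (a + b)"
    using smooth_cocycle2_trivial[of ?d] by blast
  have "is_amor (x, \<beta>, y)"
    using x y xy \<beta> by (simp add: is_amor_iff algebra_simps)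
  then show ?thesis by (rule that)
qed


section \<open>Identification of the invariants\<close>

definition character :: "'n::finite zvec \<Rightarrow> 'n rvec \<Rightarrow> circle" where
  "character m a = of_real_circle (rvec m \<bullet> a)"

lemma character_add: "character (m + m') a = character m a + character m' a"
  by (simp add: character_def rvec_add inner_add_left of_real_circle_add)

lemma character_diff: "character (m - m') a = character m a - character m' a"
  using character_add[of "m - m'" m' a] by simp

lemma character_zero [simp]: "character 0 a = 0"
  by (simp add: character_def)

lemma character_Opm_act:
  "A \<in> carrier Opm \<Longrightarrow> character (Opm_act A m) (rmat A *v a) = zscale (isosign A) (character m a)"
  by (simp add: character_def Opm_act_inner zscale_of_real)

lemma character_eqI:
  assumes "A \<in> carrier Opm" "\<And>a. character m (rmat A *v a) = character m' (rmat A *v a)"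
  shows "m = m'"
proof (rule character_inject)
  fix a
  show "of_real_circle (rvec m \<bullet> a) = of_real_circle (rvec m' \<bullet> a)"
    using assms(2)[of "rmat (matrix_inv A) *v a"]
    by (simp add: Opm_inverse_vec[OF assms(1)] character_def)
qed

lemma pi1_eq: "strict_AUT_TD_pi1 m = ((mat 1, \<lambda>_. 0), character m, (mat 1, \<lambda>_. 0))"
  by (simp add: strict_AUT_TD_pi1_def character_def[abs_def])

lemma automorphism_one_iff_character:
  "is_amor ((mat 1, \<lambda>_. 0), \<beta>, (mat 1, \<lambda>_. 0)) \<longleftrightarrow> (\<exists>m. \<beta> = character m)"
proof
  assume *: "is_amor ((mat 1, \<lambda>_. 0), \<beta>, (mat 1, \<lambda>_. 0))"
  then obtain m where "\<And>a. \<beta> a = of_real_circle (rvec m \<bullet> a)"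
    by (auto simp: is_amor_iff intro: smooth_hom_eq_character[of \<beta>])
  then show "\<exists>m. \<beta> = character m"
    by (auto simp: character_def fun_eq_iff)
next
  assume "\<exists>m. \<beta> = character m"
  then obtain m where \<beta>: "\<beta> = character m" ..
  have "smooth_circle (character m)"
    unfolding character_def[abs_def]
    by (intro smooth_circle_of_real smooth_on_bounded_linear bounded_linear_inner_right open_UNIV)
  moreover have "character m (rvec m') = 0" for m'
    unfolding character_def of_real_circle_eq_0_iff inner_rvec by (rule Ints_of_int)
  moreover have "character m a + character m b = character m (a + b)" for a b
    by (simp add: character_def inner_add_right of_real_circle_add)
  ultimately show "is_amor ((mat 1, \<lambda>_. 0), \<beta>, (mat 1, \<lambda>_. 0))"
    by (simp add: \<beta> is_amor_iff is_aobj_one)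
qed

lemma amult_ainv_right: "is_aobj x \<Longrightarrow> amult x (ainv x) = (mat 1, \<lambda>_. 0)"
  using group.r_inv[OF group_Obj, of x] group.inv_equality[OF group_Obj, of "ainv x" x]
  by (simp add: amult_ainv is_aobj_ainv)

lemma conjugation_idm:
  assumes x: "is_aobj x"
  shows "idm strict_AUT_TD x \<otimes>\<^bsub>Mor strict_AUT_TD\<^esub> strict_AUT_TD_pi1 m
      \<otimes>\<^bsub>Mor strict_AUT_TD\<^esub> inv\<^bsub>Mor strict_AUT_TD\<^esub> (idm strict_AUT_TD x) = strict_AUT_TD_pi1 (Opm_act (fst x) m)"
proof -
  have A: "fst x \<in> carrier Opm" using x by (simp add: is_aobj_iff)
  have "inv\<^bsub>Mor strict_AUT_TD\<^esub> (idm strict_AUT_TD x) = idm strict_AUT_TD (ainv x)"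
    by (rule group.inv_equality[OF group_Mor])
      (simp_all add: x amult_ainv is_amor_idm is_aobj_ainv)
  moreover have "zscale (isosign (fst x)) (character m (rmat (matrix_inv (fst x)) *v a))
      = character (Opm_act (fst x) m) a" for a
    using character_Opm_act[OF A, of m "rmat (matrix_inv (fst x)) *v a"]
    by (simp add: Opm_inverse_vec[OF A])
  ultimately show ?thesis
    by (simp add: pi1_eq amult_one amult_ainv_right x fun_eq_iff)
qed

lemma identified_two_group_AUT_TD:
  "identified_two_group (strict_AUT_TD :: ('n::{finite,linorder} aobj, 'n amor) two_group_data)
     Opm Opm_act fst strict_AUT_TD_pi1"
  (is "identified_two_group ?\<Gamma> _ _ _ _")
proof (intro identified_two_group.intro identified_two_group_axioms.intro)
  show "strict_two_group ?\<Gamma>" by (rule strict_two_group_AUT_TD)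
  show "group (Opm :: 'n zmat monoid)" by (rule group_Opm)
  show "fst \<in> hom (Obj ?\<Gamma>) Opm"
    by (simp add: hom_def is_aobj_iff)
  show "fst ` carrier (Obj ?\<Gamma>) = carrier Opm"
  proof
    show "fst ` carrier (Obj ?\<Gamma>) \<subseteq> carrier Opm" by (auto simp: is_aobj_iff)
    show "carrier Opm \<subseteq> fst ` carrier (Obj ?\<Gamma>)"
    proof
      fix A :: "'n zmat" assume "A \<in> carrier Opm"
      then show "A \<in> fst ` carrier (Obj ?\<Gamma>)"
        using is_aobj_std_obj[of A] by (intro image_eqI[of _ _ "std_obj A"]) simp_all
    qed
  qed
next
  fix x y assume "x \<in> carrier (Obj ?\<Gamma>)" "y \<in> carrier (Obj ?\<Gamma>)"
  then have xy: "is_aobj x" "is_aobj y" by simp_all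
  show "fst x = fst y \<longleftrightarrow> (\<exists>f\<in>carrier (Mor ?\<Gamma>). src ?\<Gamma> f = x \<and> tgt ?\<Gamma> f = y)"
  proof
    assume "fst x = fst y"
    with xy obtain \<beta> where "is_amor (x, \<beta>, y)" by (rule isomorphic_if_same_matrix)
    then show "\<exists>f\<in>carrier (Mor ?\<Gamma>). src ?\<Gamma> f = x \<and> tgt ?\<Gamma> f = y"
      by (intro bexI[of _ "(x, \<beta>, y)"]) simp_all
  next
    assume "\<exists>f\<in>carrier (Mor ?\<Gamma>). src ?\<Gamma> f = x \<and> tgt ?\<Gamma> f = y"
    then obtain f where f: "is_amor f" "src ?\<Gamma> f = x" "tgt ?\<Gamma> f = y" by auto
    obtain x' \<beta> y' where "f = (x', \<beta>, y')" by (rule prod_cases3)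
    then show "fst x = fst y" using f by (simp add: is_amor_iff)
  qed
next
  show "bij_betw strict_AUT_TD_pi1 UNIV
    {f \<in> carrier (Mor ?\<Gamma>). src ?\<Gamma> f = \<one>\<^bsub>Obj ?\<Gamma>\<^esub> \<and> tgt ?\<Gamma> f = \<one>\<^bsub>Obj ?\<Gamma>\<^esub>}"
    unfolding bij_betw_def
  proof
    show "inj (strict_AUT_TD_pi1 :: 'n zvec \<Rightarrow> 'n amor)"
    proof (rule injI)
      fix m m' :: "'n zvec" assume "strict_AUT_TD_pi1 m = strict_AUT_TD_pi1 m'"
      then have "character m a = character m' a" for a
        by (simp add: pi1_eq)
      then show "m = m'" unfolding character_def by (rule character_inject)
    qed
    have "f \<in> range strict_AUT_TD_pi1 \<longleftrightarrow>
        is_amor f \<and> src ?\<Gamma> f = (mat 1, \<lambda>_. 0) \<and> tgt ?\<Gamma> f = (mat 1, \<lambda>_. 0)" for f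
    proof -
      obtain x \<beta> y where f: "f = (x, \<beta>, y)" by (rule prod_cases3)
      have "is_amor f \<and> x = (mat 1, \<lambda>_. 0) \<and> y = (mat 1, \<lambda>_. 0)
          \<longleftrightarrow> (\<exists>m. \<beta> = character m) \<and> x = (mat 1, \<lambda>_. 0) \<and> y = (mat 1, \<lambda>_. 0)"
        using automorphism_one_iff_character[of \<beta>] f by auto
      then show ?thesis by (auto simp: f pi1_eq)
    qed
    then show "range strict_AUT_TD_pi1 =
        {f \<in> carrier (Mor ?\<Gamma>). src ?\<Gamma> f = \<one>\<^bsub>Obj ?\<Gamma>\<^esub> \<and> tgt ?\<Gamma> f = \<one>\<^bsub>Obj ?\<Gamma>\<^esub>}"
      by (simp add: set_eq_iff del: split_paired_All)
  qed
next
  fix m m' :: "'n zvec"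
  show "strict_AUT_TD_pi1 (m + m') = vcomp ?\<Gamma> (strict_AUT_TD_pi1 m) (strict_AUT_TD_pi1 m')"
    by (simp add: pi1_eq character_add[abs_def] fun_eq_iff)
next
  fix x :: "'n aobj" and m :: "'n zvec" assume "x \<in> carrier (Obj ?\<Gamma>)"
  then have "is_aobj x" by simp
  from conjugation_idm[OF this, of m, symmetric]
  show "strict_AUT_TD_pi1 (Opm_act (fst x) m) = idm ?\<Gamma> x \<otimes>\<^bsub>Mor ?\<Gamma>\<^esub> strict_AUT_TD_pi1 m
      \<otimes>\<^bsub>Mor ?\<Gamma>\<^esub> inv\<^bsub>Mor ?\<Gamma>\<^esub> (idm ?\<Gamma> x)"
    .
qed


section \<open>The k-invariant is well defined\<close>

text \<open>Additivity of the action makes the coboundaries a subgroup, so \<open>cohomologous3 G act\<close> is an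
  equivalence relation on cocycles.\<close>

lemma H3_class_eqI:
  fixes act :: "'g \<Rightarrow> 'a \<Rightarrow> 'a::ab_group_add"
  assumes act_add: "\<And>g a b. act g (a + b) = act g a + act g b"
    and cc': "(c, c') \<in> cohomologous3 G act"
  shows "H3_class G act c = H3_class G act c'"
proof -
  have act_minus: "act g (- a) = - act g a" for g a
    using act_add[of g a "- a"] act_add[of g 0 0]
    by (simp add: eq_neg_iff_add_eq_0 add.commute)
  have sym: "(d', d) \<in> cohomologous3 G act" if dd': "(d, d') \<in> cohomologous3 G act" for d d'
  proof -
    obtain b where b: "\<And>g h k. \<lbrakk>g \<in> carrier G; h \<in> carrier G; k \<in> carrier G\<rbrakk> \<Longrightarrow>
        d g h k - d' g h k = act g (b h k) - b (g \<otimes>\<^bsub>G\<^esub> h) k + b g (h \<otimes>\<^bsub>G\<^esub> k) - b g h"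
      using dd' by (auto simp: cohomologous3_def coboundaries3_def)
    have "d' g h k - d g h k = act g (- b h k) - (- b (g \<otimes>\<^bsub>G\<^esub> h) k) + (- b g (h \<otimes>\<^bsub>G\<^esub> k)) - (- b g h)"
      if "g \<in> carrier G" "h \<in> carrier G" "k \<in> carrier G" for g h k
      using arg_cong[OF b[OF that], of uminus] by (simp add: act_minus)
    then have "(\<lambda>g h k. d' g h k - d g h k) \<in> coboundaries3 G act"
      by (auto simp: coboundaries3_def intro!: exI[of _ "\<lambda>g h. - b g h"])
    then show ?thesis using dd' by (simp add: cohomologous3_def)
  qed
  have trans: "(d, d'') \<in> cohomologous3 G act"
    if dd': "(d, d') \<in> cohomologous3 G act" and dd'': "(d', d'') \<in> cohomologous3 G act" for d d' d''
  proof -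
    obtain b where b: "\<And>g h k. \<lbrakk>g \<in> carrier G; h \<in> carrier G; k \<in> carrier G\<rbrakk> \<Longrightarrow>
        d g h k - d' g h k = act g (b h k) - b (g \<otimes>\<^bsub>G\<^esub> h) k + b g (h \<otimes>\<^bsub>G\<^esub> k) - b g h"
      using dd' by (auto simp: cohomologous3_def coboundaries3_def)
    obtain b' where b': "\<And>g h k. \<lbrakk>g \<in> carrier G; h \<in> carrier G; k \<in> carrier G\<rbrakk> \<Longrightarrow>
        d' g h k - d'' g h k = act g (b' h k) - b' (g \<otimes>\<^bsub>G\<^esub> h) k + b' g (h \<otimes>\<^bsub>G\<^esub> k) - b' g h"
      using dd'' by (auto simp: cohomologous3_def coboundaries3_def)
    have "d g h k - d'' g h k = act g (b h k + b' h k) - (b (g \<otimes>\<^bsub>G\<^esub> h) k + b' (g \<otimes>\<^bsub>G\<^esub> h) k)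
        + (b g (h \<otimes>\<^bsub>G\<^esub> k) + b' g (h \<otimes>\<^bsub>G\<^esub> k)) - (b g h + b' g h)"
      if "g \<in> carrier G" "h \<in> carrier G" "k \<in> carrier G" for g h k
    proof -
      have "d g h k - d'' g h k = (d g h k - d' g h k) + (d' g h k - d'' g h k)" by simp
      then show ?thesis unfolding b[OF that] b'[OF that] by (simp add: act_add algebra_simps)
    qed
    then have "(\<lambda>g h k. d g h k - d'' g h k) \<in> coboundaries3 G act"
      by (auto simp: coboundaries3_def intro!: exI[of _ "\<lambda>g h. b g h + b' g h"])
    then show ?thesis using dd' dd'' by (simp add: cohomologous3_def)
  qed
  show ?thesis
    unfolding H3_class_def using sym[OF cc'] trans cc' by blast
qed

text \<open>The pasting equation of the k-invariant, read off on underlying functions. Whiskering with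
  identities on the right precomposes with the matrix, whiskering on the left multiplies with the sign.\<close>

lemma k_cocycleD:
  assumes k: "k_cocycle strict_AUT_TD Opm fst strict_AUT_TD_pi1 S \<beta> \<xi>"
  defines "b \<equiv> \<lambda>g h. fst (snd (\<beta> g h))"
  shows "g \<in> carrier Opm \<Longrightarrow> is_aobj (S g)"
    and "g \<in> carrier Opm \<Longrightarrow> fst (S g) = g"
    and "\<lbrakk>g \<in> carrier Opm; h \<in> carrier Opm\<rbrakk> \<Longrightarrow> is_amor (amult (S g) (S h), b g h, S (g ** h))"
    and "\<lbrakk>g \<in> carrier Opm; h \<in> carrier Opm; k \<in> carrier Opm\<rbrakk> \<Longrightarrow>
      character (\<xi> g h k) (rmat (g ** h ** k) *v a) + b (g ** h) k a + b g h (rmat k *v a)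
      = b g (h ** k) a + zscale (isosign g) (b h k a)"
proof -
  have S: "is_aobj (S g) \<and> fst (S g) = g" if "g \<in> carrier Opm" for g
    using k that by (simp add: k_cocycle_def)
  then show "g \<in> carrier Opm \<Longrightarrow> is_aobj (S g)" and "g \<in> carrier Opm \<Longrightarrow> fst (S g) = g"
    by auto
  have \<beta>: "\<beta> g h = (amult (S g) (S h), b g h, S (g ** h))" "is_amor (\<beta> g h)"
    if "g \<in> carrier Opm" "h \<in> carrier Opm" for g h
  proof -
    have *: "is_amor (\<beta> g h)" "src strict_AUT_TD (\<beta> g h) = amult (S g) (S h)"
      "tgt strict_AUT_TD (\<beta> g h) = S (g ** h)"
      using k that by (simp_all add: k_cocycle_def)
    then show "is_amor (\<beta> g h)" by simp
    obtain x \<gamma> y where "\<beta> g h = (x, \<gamma>, y)" by (rule prod_cases3)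
    with * show "\<beta> g h = (amult (S g) (S h), b g h, S (g ** h))"
      by (simp add: b_def)
  qed
  show "is_amor (amult (S g) (S h), b g h, S (g ** h))" if "g \<in> carrier Opm" "h \<in> carrier Opm"
    using \<beta>[OF that] by simp
  assume g: "g \<in> carrier Opm" and h: "h \<in> carrier Opm" and k': "k \<in> carrier Opm"
  let ?\<Gamma> = strict_AUT_TD
  have "vcomp ?\<Gamma>
          (vcomp ?\<Gamma> (strict_AUT_TD_pi1 (\<xi> g h k) \<otimes>\<^bsub>Mor ?\<Gamma>\<^esub> idm ?\<Gamma> (S (g ** h ** k))) (\<beta> (g ** h) k))
          (\<beta> g h \<otimes>\<^bsub>Mor ?\<Gamma>\<^esub> idm ?\<Gamma> (S k))
        = vcomp ?\<Gamma> (\<beta> g (h ** k)) (idm ?\<Gamma> (S g) \<otimes>\<^bsub>Mor ?\<Gamma>\<^esub> \<beta> h k)"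
    using k g h k' by (simp add: k_cocycle_def)
  then show "character (\<xi> g h k) (rmat (g ** h ** k) *v a) + b (g ** h) k a + b g h (rmat k *v a)
      = b g (h ** k) a + zscale (isosign g) (b h k a)"
    using g h k' S by (simp add: \<beta> Opm_mult_closed pi1_eq fun_eq_iff)
qed

text \<open>The hypothesis says that \<open>\<xi>\<close> is a coboundary in circle-valued functions, so its own
  coboundary vanishes there; characters separate integer vectors.\<close>

lemma cocycle_of_circle_cochain:
  assumes key: "\<And>g h k a. \<lbrakk>g \<in> carrier Opm; h \<in> carrier Opm; k \<in> carrier Opm\<rbrakk> \<Longrightarrow>
      character (\<xi> g h k) (rmat (g ** h ** k) *v a) + b (g ** h) k a + b g h (rmat k *v a)
      = b g (h ** k) a + zscale (isosign g) (b h k a)"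
  shows "\<xi> \<in> cocycles3 Opm Opm_act"
proof -
  have key': "character (\<xi> g h k) (rmat (g ** h ** k) *v a)
      = b g (h ** k) a + zscale (isosign g) (b h k a) - b (g ** h) k a - b g h (rmat k *v a)"
    if "g \<in> carrier Opm" "h \<in> carrier Opm" "k \<in> carrier Opm" for g h k a
    using key[OF that, of a] by (simp add: algebra_simps)
  have "Opm_act g (\<xi> h k l) - \<xi> (g ** h) k l + \<xi> g (h ** k) l - \<xi> g h (k ** l) + \<xi> g h k = 0"
    if G: "g \<in> carrier Opm" "h \<in> carrier Opm" "k \<in> carrier Opm" "l \<in> carrier Opm" for g h k l
  proof (rule character_eqI)
    show "g ** h ** k ** l \<in> carrier Opm" using G by (simp add: Opm_mult_closed)
    fix a
    let ?a = "rmat (g ** h ** k ** l) *v a"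
    have 1: "character (Opm_act g (\<xi> h k l)) ?a = zscale (isosign g) (character (\<xi> h k l) (rmat (h ** k ** l) *v a))"
      using character_Opm_act[OF G(1), of "\<xi> h k l" "rmat (h ** k ** l) *v a"]
      by (simp add: rmat_mult_vec)
    have 3: "character (\<xi> g (h ** k) l) ?a = character (\<xi> g (h ** k) l) (rmat (g ** (h ** k) ** l) *v a)"
      and 4: "character (\<xi> g h (k ** l)) ?a = character (\<xi> g h (k ** l)) (rmat (g ** h ** (k ** l)) *v a)"
      and 5: "character (\<xi> g h k) ?a = character (\<xi> g h k) (rmat (g ** h ** k) *v (rmat l *v a))"
      by (simp_all add: rmat_mult_vec)
    have GH: "g ** h \<in> carrier Opm" "h ** k \<in> carrier Opm" "k ** l \<in> carrier Opm"
      using G by (simp_all add: Opm_mult_closed)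
    show "character (Opm_act g (\<xi> h k l) - \<xi> (g ** h) k l + \<xi> g (h ** k) l - \<xi> g h (k ** l) + \<xi> g h k) ?a
        = character 0 ?a"
      unfolding character_add character_diff 1 3 4 5
        key'[OF G(2-4)] key'[OF GH(1) G(3,4)] key'[OF G(1) GH(2) G(4)] key'[OF G(1,2) GH(3)] key'[OF G(1-3)]
      using G by (simp add: Opm_mult_closed zscale_add zscale_diff zscale_zscale rmat_mult_vec
          matrix_mul_assoc algebra_simps)
  qed
  then show ?thesis by (simp add: cocycles3_def)
qed

lemma k_cocycle_in_cocycles3:
  "k_cocycle strict_AUT_TD Opm fst strict_AUT_TD_pi1 S \<beta> \<xi> \<Longrightarrow> \<xi> \<in> cocycles3 Opm Opm_act"
  by (rule cocycle_of_circle_cochain[of \<xi> "\<lambda>g h. fst (snd (\<beta> g h))"]) (rule k_cocycleD(4))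

text \<open>Transporting \<open>b'\<close> along isomorphisms \<open>\<gamma>\<close> between the two sections gives two parallel isomorphisms
  \<open>S g \<cdot> S h \<rightarrow> S (gh)\<close>. Their difference \<open>u\<close> is an automorphism, hence a character \<open>c\<close>; and the coboundary
  of \<open>\<gamma>\<close> does not contribute to \<open>\<xi> - \<xi>'\<close>.\<close>

lemma k_cocycles_cohomologous:
  assumes k: "k_cocycle strict_AUT_TD Opm fst strict_AUT_TD_pi1 S \<beta> \<xi>"
    and k': "k_cocycle strict_AUT_TD Opm fst strict_AUT_TD_pi1 S' \<beta>' \<xi>'"
  shows "(\<xi>, \<xi>') \<in> cohomologous3 Opm Opm_act"
proof -
  define b where "b g h = fst (snd (\<beta> g h))" for g h
  define b' where "b' g h = fst (snd (\<beta>' g h))" for g h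
  note S = k_cocycleD(1,2)[OF k] k_cocycleD(1,2)[OF k']
  note mor = k_cocycleD(3)[OF k, folded b_def] k_cocycleD(3)[OF k', folded b'_def]
  note key = k_cocycleD(4)[OF k, folded b_def] k_cocycleD(4)[OF k', folded b'_def]
  have "\<exists>\<gamma>. is_amor (S g, \<gamma>, S' g)" if "g \<in> carrier Opm" for g
    using isomorphic_if_same_matrix[of "S g" "S' g"] S that by metis
  then obtain \<gamma> where \<gamma>: "\<And>g. g \<in> carrier Opm \<Longrightarrow> is_amor (S g, \<gamma> g, S' g)" by metis
  define u where "u g h a = b g h a - b' g h a + \<gamma> (g ** h) a - \<gamma> g (rmat h *v a) - zscale (isosign g) (\<gamma> h a)"
    for g h a
  have "\<exists>c. \<forall>a. character c (rmat (g ** h) *v a) = u g h a"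
    if G: "g \<in> carrier Opm" "h \<in> carrier Opm" for g h
  proof -
    have gh: "g ** h \<in> carrier Opm" using G by (simp add: Opm_mult_closed)
    have "smooth_circle (u g h)"
      unfolding u_def[abs_def]
      using mor(1)[OF G] mor(2)[OF G] \<gamma>[OF G(1)] \<gamma>[OF G(2)] \<gamma>[OF gh]
      by (intro smooth_circle_add smooth_circle_diff smooth_circle_zscale
          smooth_circle_compose_linear[OF _ matrix_vector_mul_bounded_linear]) (simp_all add: is_amor_iff)
    then have "smooth_circle (\<lambda>a. u g h (rmat (matrix_inv (g ** h)) *v a))"
      by (rule smooth_circle_compose_linear[OF _ matrix_vector_mul_bounded_linear])
    moreover have "u g h (x + y) = u g h x + u g h y" for x y
    proof -
      have e1: "b g h (x + y) = b g h x + b g h y + snd (amult (S g) (S h)) (x, y) - snd (S (g ** h)) (x, y)"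
        and e2: "b' g h (x + y) = b' g h x + b' g h y + snd (amult (S' g) (S' h)) (x, y) - snd (S' (g ** h)) (x, y)"
        using mor(1)[OF G] mor(2)[OF G] by (simp_all add: is_amor_iff algebra_simps)
      have e3: "\<gamma> g' (x + y) = \<gamma> g' x + \<gamma> g' y + snd (S g') (x, y) - snd (S' g') (x, y)"
        if "g' \<in> carrier Opm" for g' x y
        using \<gamma>[OF that] by (simp add: is_amor_iff algebra_simps)
      show ?thesis
        unfolding u_def e1 e2
        using G gh S by (simp add: e3 matrix_vector_right_distrib zscale_add zscale_diff algebra_simps)
    qed
    then have "u g h (rmat (matrix_inv (g ** h)) *v (x + y))
        = u g h (rmat (matrix_inv (g ** h)) *v x) + u g h (rmat (matrix_inv (g ** h)) *v y)" for x y
      by (simp add: matrix_vector_right_distrib)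
    moreover have "u g h (rmat (matrix_inv (g ** h)) *v rvec m) = 0" for m
      using mor(1)[OF G] mor(2)[OF G] \<gamma>[OF G(1)] \<gamma>[OF G(2)] \<gamma>[OF gh]
      by (simp add: u_def rmat_rvec is_amor_iff)
    ultimately obtain c where "\<And>a. u g h (rmat (matrix_inv (g ** h)) *v a) = of_real_circle (rvec c \<bullet> a)"
      using smooth_hom_eq_character[of "\<lambda>a. u g h (rmat (matrix_inv (g ** h)) *v a)"] by blast
    then have "character c (rmat (g ** h) *v a) = u g h a" for a
      by (metis character_def Opm_inverse_vec(2)[OF gh])
    then show ?thesis by blast
  qed
  then obtain c where c: "\<And>g h a. \<lbrakk>g \<in> carrier Opm; h \<in> carrier Opm\<rbrakk> \<Longrightarrow>
      character (c g h) (rmat (g ** h) *v a) = u g h a" by metis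
  have "\<xi> g h k - \<xi>' g h k = Opm_act g (c h k) - c (g ** h) k + c g (h ** k) - c g h"
    if G: "g \<in> carrier Opm" "h \<in> carrier Opm" "k \<in> carrier Opm" for g h k
  proof (rule character_eqI)
    show "g ** h ** k \<in> carrier Opm" using G by (simp add: Opm_mult_closed)
    fix a
    let ?a = "rmat (g ** h ** k) *v a"
    have x: "character (\<xi> g h k) ?a = b g (h ** k) a + zscale (isosign g) (b h k a) - b (g ** h) k a - b g h (rmat k *v a)"
      and x': "character (\<xi>' g h k) ?a = b' g (h ** k) a + zscale (isosign g) (b' h k a) - b' (g ** h) k a - b' g h (rmat k *v a)"
      using key(1)[OF G, of a] key(2)[OF G, of a] by (simp_all add: algebra_simps)
    have 1: "character (Opm_act g (c h k)) ?a = zscale (isosign g) (character (c h k) (rmat (h ** k) *v a))"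
      using character_Opm_act[OF G(1), of "c h k" "rmat (h ** k) *v a"]
      by (simp add: rmat_mult_vec)
    have 3: "character (c g (h ** k)) ?a = character (c g (h ** k)) (rmat (g ** (h ** k)) *v a)"
      and 4: "character (c g h) ?a = character (c g h) (rmat (g ** h) *v (rmat k *v a))"
      by (simp_all add: rmat_mult_vec)
    have GH: "g ** h \<in> carrier Opm" "h ** k \<in> carrier Opm"
      using G by (simp_all add: Opm_mult_closed)
    show "character (\<xi> g h k - \<xi>' g h k) ?a
        = character (Opm_act g (c h k) - c (g ** h) k + c g (h ** k) - c g h) ?a"
      unfolding character_add character_diff 1 3 4 x x'
        c[OF G(2,3)] c[OF GH(1) G(3)] c[OF G(1) GH(2)] c[OF G(1,2)]
      using G by (simp add: u_def Opm_mult_closed zscale_add zscale_diff zscale_zscale rmat_mult_vec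
          matrix_mul_assoc algebra_simps)
  qed
  then have "(\<lambda>g h k. \<xi> g h k - \<xi>' g h k) \<in> coboundaries3 Opm Opm_act"
    by (auto simp: coboundaries3_def)
  then show ?thesis
    using k_cocycle_in_cocycles3[OF k] k_cocycle_in_cocycles3[OF k'] by (simp add: cohomologous3_def)
qed


lemma k_invariant_eq_H3_class:
  fixes \<xi> :: "'n::finite zmat \<Rightarrow> 'n zmat \<Rightarrow> 'n zmat \<Rightarrow> 'n zvec"
  assumes k: "k_cocycle strict_AUT_TD Opm fst strict_AUT_TD_pi1 S \<beta> \<xi>"
  shows "k_invariant strict_AUT_TD Opm Opm_act fst strict_AUT_TD_pi1 = H3_class Opm Opm_act \<xi>"
  unfolding k_invariant_def
proof (rule the_equality)
  show "\<exists>S \<beta> \<xi>'. k_cocycle strict_AUT_TD Opm fst strict_AUT_TD_pi1 S \<beta> \<xi>' \<and>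
      H3_class Opm Opm_act \<xi> = H3_class Opm Opm_act \<xi>'"
    using k by blast
next
  fix \<kappa> :: "('n zmat \<Rightarrow> 'n zmat \<Rightarrow> 'n zmat \<Rightarrow> 'n zvec) set"
  assume "\<exists>S \<beta> \<xi>. k_cocycle strict_AUT_TD Opm fst strict_AUT_TD_pi1 S \<beta> \<xi> \<and>
      \<kappa> = H3_class Opm Opm_act \<xi>"
  then obtain S' \<beta>' \<xi>' where k': "k_cocycle strict_AUT_TD Opm fst strict_AUT_TD_pi1 S' \<beta>' \<xi>'"
    and \<kappa>: "\<kappa> = H3_class Opm Opm_act \<xi>'" by blast
  show "\<kappa> = H3_class Opm Opm_act \<xi>"
    unfolding \<kappa>
    by (rule H3_class_eqI[OF Opm_act_add k_cocycles_cohomologous[OF k' k]])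
qed


section \<open>The explicit cocycle\<close>

lemma low_0 [simp]: "low 0 = 0"
  by (simp add: low_def vec_eq_iff)

lemma low_diag [simp]: "low B $ i $ i = 0"
  by (simp add: low_def index_less_irrefl)

text \<open>The bilinear form by which the product of the bilinear cocycles of \<open>A\<close> and \<open>B\<close> differs from that
  of \<open>AB\<close>.\<close>

definition twist_form :: "'n::{finite,linorder} zmat \<Rightarrow> 'n zmat \<Rightarrow> 'n rvec \<Rightarrow> 'n rvec \<Rightarrow> real" where
  "twist_form A B a b = mform (low (Bmat A)) (rmat B *v a) (rmat B *v b)
     + isosign A * mform (low (Bmat B)) a b - mform (low (Bmat (A ** B))) a b"

text \<open>The diagonal of \<open>twist_form A B\<close>: the two other summands are strictly triangular.\<close>

definition twist_diag :: "'n::{finite,linorder} zmat \<Rightarrow> 'n zmat \<Rightarrow> 'n zvec" where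
  "twist_diag A B = diagvec (transpose B ** low (Bmat A) ** B)"

text \<open>Quadratic functions \<open>q(a,a)/2\<close> trivialise symmetric bilinear cocycles. The linear term, half of
  the diagonal of \<open>q\<close>, makes the values at integer vectors integers; either sign would do, and the
  positive one leads to \<open>m_expr\<close>.\<close>

definition twist :: "'n::{finite,linorder} zmat \<Rightarrow> 'n zmat \<Rightarrow> 'n rvec \<Rightarrow> real" where
  "twist A B a = (twist_form A B a a + rvec (twist_diag A B) \<bullet> a) / 2"

lemma twist_form_add:
  "twist_form A B (a + a') b = twist_form A B a b + twist_form A B a' b"
  "twist_form A B b (a + a') = twist_form A B b a + twist_form A B b a'"
  by (simp_all add: twist_form_def mform_bilinear matrix_vector_right_distrib algebra_simps)

text \<open>Antisymmetrising each term gives \<open>\<B>\<close>, and these cancel by its cocycle identity.\<close>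

lemma twist_form_sym:
  assumes "A \<in> carrier Opm" "B \<in> carrier Opm"
  shows "twist_form A B a b = twist_form A B b a"
proof -
  have "twist_form A B a b - twist_form A B b a
      = (mform (low (Bmat A)) (rmat B *v a) (rmat B *v b) - mform (low (Bmat A)) (rmat B *v b) (rmat B *v a))
      + isosign A * (mform (low (Bmat B)) a b - mform (low (Bmat B)) b a)
      - (mform (low (Bmat (A ** B))) a b - mform (low (Bmat (A ** B))) b a)"
    by (simp add: twist_form_def algebra_simps)
  also have "\<dots> = 0"
    using assms by (simp add: mform_low_diff Opm_mult_closed mform_Bmat_mult)
  finally show ?thesis by simp
qed

lemma twist_form_int: "twist_form A B (rvec m) (rvec m') \<in> \<int>"
  unfolding twist_form_def rmat_rvec by (intro Ints_add Ints_diff Ints_mult Ints_of_int mform_rvec)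

lemma twist_form_axis: "twist_form A B (axis i 1) (axis i 1) = real_of_int (twist_diag A B $ i)"
proof -
  have "mform (low (Bmat A)) (rmat B *v axis i 1) (rmat B *v axis i 1)
      = mform (transpose B ** low (Bmat A) ** B) (axis i 1) (axis i 1)"
    by (simp only: mform_congruence)
  then show ?thesis
    unfolding twist_form_def twist_diag_def diagvec_def by (simp add: mform_axis)
qed

lemma twist_add:
  assumes "A \<in> carrier Opm" "B \<in> carrier Opm"
  shows "twist A B (a + b) = twist A B a + twist A B b + twist_form A B a b"
  by (simp add: twist_def twist_form_add twist_form_sym[OF assms, of b a] inner_add_right field_simps)

text \<open>Modulo 1 the function \<open>twist A B\<close> is additive on integer vectors, as \<open>twist_form\<close> is integral
  there; and at a basis vector its two halves add up to the integer diagonal entry.\<close>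

lemma twist_rvec:
  assumes "A \<in> carrier Opm" "B \<in> carrier Opm"
  shows "of_real_circle (twist A B (rvec m)) = 0"
proof (rule additive_zvec_eq_0[where h = "\<lambda>m. of_real_circle (twist A B (rvec m))"])
  fix m m' :: "'a zvec"
  show "of_real_circle (twist A B (rvec (m + m'))) = of_real_circle (twist A B (rvec m)) + of_real_circle (twist A B (rvec m'))"
    using twist_form_int[of A B m m', folded of_real_circle_eq_0_iff]
    by (simp add: rvec_add twist_add[OF assms] of_real_circle_add)
next
  fix i
  have "twist A B (axis i 1) = real_of_int (twist_diag A B $ i)"
    by (simp add: twist_def twist_form_axis inner_axis)
  then show "of_real_circle (twist A B (rvec (axis i 1))) = 0"
    by (simp add: rvec_axis of_real_circle_eq_0_iff)
qed

lemma is_amor_twist: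
  assumes "A \<in> carrier Opm" "B \<in> carrier Opm"
  shows "is_amor (amult (std_obj A) (std_obj B), \<lambda>a. of_real_circle (twist A B a), std_obj (A ** B))"
proof -
  have "smooth_on UNIV (\<lambda>a. mform (low (Bmat A)) (rmat B *v a) (rmat B *v a))"
    by (rule smooth_on_quadratic[OF bounded_bilinear.comp[OF bounded_bilinear_mform
            matrix_vector_mul_bounded_linear matrix_vector_mul_bounded_linear] open_UNIV])
  moreover have "smooth_on UNIV (\<lambda>a. mform M a a)" for M
    by (rule smooth_on_quadratic[OF bounded_bilinear_mform open_UNIV])
  ultimately have "smooth_on UNIV (\<lambda>a. 1 / 2 * (twist_form A B a a + rvec (twist_diag A B) \<bullet> a))"
    unfolding twist_form_def
    by (intro smooth_on_mult_const smooth_on_add smooth_on_diff open_UNIV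
        smooth_on_bounded_linear[OF bounded_linear_inner_right])
  then have "smooth_on UNIV (twist A B)"
    by (simp add: twist_def[abs_def])
  then have "smooth_circle (\<lambda>a. of_real_circle (twist A B a))"
    by (rule smooth_circle_of_real)
  moreover have "of_real_circle (twist A B a) + of_real_circle (twist A B b) + snd (amult (std_obj A) (std_obj B)) (a, b)
      = snd (std_obj (A ** B)) (a, b) + of_real_circle (twist A B (a + b))" for a b
  proof -
    have "twist A B a + twist A B b + (mform (low (Bmat A)) (rmat B *v a) (rmat B *v b) + isosign A * mform (low (Bmat B)) a b)
        = mform (low (Bmat (A ** B))) a b + twist A B (a + b)"
      by (simp add: twist_add[OF assms] twist_form_def)
    then show ?thesis
      by (simp add: zscale_of_real flip: of_real_circle_add)
  qed
  ultimately show ?thesis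
    using assms by (simp add: is_amor_iff is_aobj_amult is_aobj_std_obj Opm_mult_closed twist_rvec)
qed

text \<open>The vector in parentheses in \<open>m_expr\<close>.\<close>

definition defect :: "'n::{finite,linorder} zmat \<Rightarrow> 'n zmat \<Rightarrow> 'n zmat \<Rightarrow> 'n zvec" where
  "defect A B C = transpose C *v diagvec (transpose B ** low (Bmat A) ** B)
     + diagvec (transpose C ** low (Bmat (A ** B)) ** C)
     - isosign A *s diagvec (transpose C ** low (Bmat B) ** C)
     - diagvec (transpose C ** transpose B ** low (Bmat A) ** B ** C)"

text \<open>The bracket is the coboundary of \<open>twist_diag\<close>, regarded as a cochain of linear functions, up to
  sign.\<close>

lemma defect_inner:
  "rvec (defect A B C) \<bullet> a = rvec (twist_diag A B) \<bullet> (rmat C *v a) + rvec (twist_diag (A ** B) C) \<bullet> a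
     - isosign A * (rvec (twist_diag B C) \<bullet> a) - rvec (twist_diag A (B ** C)) \<bullet> a"
proof -
  have 1: "defect A B C = transpose C *v twist_diag A B + twist_diag (A ** B) C
      - isosign A *s twist_diag B C - twist_diag A (B ** C)"
    by (simp add: defect_def twist_diag_def matrix_transpose_mul matrix_mul_assoc)
  have "rvec (defect A B C) = rmat (transpose C) *v rvec (twist_diag A B) + rvec (twist_diag (A ** B) C)
      - isosign A *\<^sub>R rvec (twist_diag B C) - rvec (twist_diag A (B ** C))"
    unfolding 1 rmat_rvec by (simp add: vec_eq_iff)
  then show ?thesis
    by (simp add: inner_add_left inner_diff_left inner_rmat_transpose)
qed

text \<open>The quadratic terms cancel because \<open>twist_form\<close> is itself a coboundary, namely of the cochain
  \<open>A \<mapsto> \<B>(A)\<^sub>l\<^sub>o\<^sub>w\<close>; the linear terms do not, because taking the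
  diagonal of a form does not commute with changing coordinates.\<close>

lemma twist_cocycle:
  assumes "A \<in> carrier Opm" "B \<in> carrier Opm"
  shows "- (rvec (defect A B C) \<bullet> a) / 2 + twist (A ** B) C a + twist A B (rmat C *v a)
    = twist A (B ** C) a + isosign A * twist B C a"
  unfolding twist_def twist_form_def defect_inner
  using assms by (simp add: Opm_mult_closed rmat_mult_vec matrix_mul_assoc field_simps)

text \<open>Every other term of \<open>twist_cocycle\<close> vanishes modulo 1 at integer vectors.\<close>

lemma defect_even:
  assumes "A \<in> carrier Opm" "B \<in> carrier Opm" "C \<in> carrier Opm"
  shows "even (defect A B C $ i)"
proof -
  have "of_real_circle (- (rvec (defect A B C) \<bullet> rvec (axis i 1)) / 2) + of_real_circle (twist (A ** B) C (rvec (axis i 1)))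
        + of_real_circle (twist A B (rvec (C *v axis i 1)))
      = of_real_circle (twist A (B ** C) (rvec (axis i 1))) + zscale (isosign A) (of_real_circle (twist B C (rvec (axis i 1))))"
    using arg_cong[OF twist_cocycle[OF assms(1,2), of C "rvec (axis i 1)"], of of_real_circle]
    by (simp only: of_real_circle_add zscale_of_real rmat_rvec)
  then have "of_real_circle (- real_of_int (defect A B C $ i) / 2) = 0"
    using assms by (simp add: twist_rvec Opm_mult_closed) (simp add: rvec_axis inner_axis)
  then obtain k where "- real_of_int (defect A B C $ i) / 2 = of_int k"
    unfolding of_real_circle_eq_0_iff by (rule Ints_cases)
  then have "real_of_int (defect A B C $ i) = real_of_int (2 * (- k))" by simp
  then have "defect A B C $ i = 2 * (- k)" by (simp only: of_int_eq_iff)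
  then show ?thesis by simp
qed

text \<open>The integer division is exact by \<open>defect_even\<close>.\<close>

definition m_cocycle :: "'n::{finite,linorder} zmat \<Rightarrow> 'n zmat \<Rightarrow> 'n zmat \<Rightarrow> 'n zvec" where
  "m_cocycle A B C = (matrix_inv (transpose A) ** matrix_inv (transpose B) ** matrix_inv (transpose C)) *v
     (\<chi> i. - (defect A B C $ i div 2))"

lemma rvec_half_defect:
  assumes "A \<in> carrier Opm" "B \<in> carrier Opm" "C \<in> carrier Opm"
  shows "rvec (\<chi> i. - (defect A B C $ i div 2)) = (- 1 / 2) *\<^sub>R rvec (defect A B C)"
  using defect_even[OF assms] by (auto simp: vec_eq_iff real_of_int_div)

lemma rvec_m_cocycle:
  assumes "A \<in> carrier Opm" "B \<in> carrier Opm" "C \<in> carrier Opm"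
  shows "rvec (m_cocycle A B C) = m_expr A B C"
  unfolding m_cocycle_def m_expr_def defect_def[symmetric]
  by (simp only: rmat_rvec[symmetric] rvec_half_defect[OF assms] matrix_vector_mult_scaleR)

lemma inner_inverse_transpose:
  assumes "A \<in> carrier Opm"
  shows "(rmat (matrix_inv (transpose A)) *v x) \<bullet> (rmat A *v y) = x \<bullet> y"
proof -
  have "\<exists>B. transpose A ** B = mat 1 \<and> B ** transpose A = mat 1"
    using Opm_inverse[OF assms] by (intro exI[of _ "transpose (matrix_inv A)"])
      (simp flip: matrix_transpose_mul)
  then have "transpose A ** matrix_inv (transpose A) = mat 1"
    unfolding matrix_inv_def by (rule someI2_ex) simp
  then have "rmat (transpose A) *v (rmat (matrix_inv (transpose A)) *v x) = x"
    by (simp flip: rmat_mult_vec)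
  then show ?thesis by (simp flip: inner_rmat_transpose)
qed

lemma m_cocycle_inner:
  assumes "A \<in> carrier Opm" "B \<in> carrier Opm" "C \<in> carrier Opm"
  shows "rvec (m_cocycle A B C) \<bullet> (rmat (A ** B ** C) *v a) = - (rvec (defect A B C) \<bullet> a) / 2"
proof -
  have "m_expr A B C = (- 1 / 2) *\<^sub>R
      (rmat (matrix_inv (transpose A) ** matrix_inv (transpose B) ** matrix_inv (transpose C)) *v rvec (defect A B C))"
    by (simp only: m_expr_def defect_def)
  then show ?thesis
    using assms by (simp add: rvec_m_cocycle inner_inverse_transpose rmat_mult_vec)
qed

lemma k_cocycle_m_cocycle:
  "k_cocycle strict_AUT_TD Opm fst strict_AUT_TD_pi1 std_obj
    (\<lambda>A B. (amult (std_obj A) (std_obj B), \<lambda>a. of_real_circle (twist A B a), std_obj (A ** B)))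
    (m_cocycle :: 'n::{finite,linorder} zmat \<Rightarrow> 'n zmat \<Rightarrow> 'n zmat \<Rightarrow> 'n zvec)"
proof -
  have S1: "std_obj (mat 1 :: 'n zmat) = (mat 1, \<lambda>_. 0)"
    by (rule aobj_eqI) (simp_all add: Bmat_1)
  have diag0: "diagvec (0 :: 'n zmat) = 0" by (simp add: diagvec_def vec_eq_iff)
  have z: "rmat (0 :: 'n zmat) *v a = 0" "rvec (0 :: 'n zvec) \<bullet> a = 0" for a :: "'n rvec"
    by (simp_all add: vec_eq_iff matrix_vector_mult_def)
  have t1: "twist (mat 1) A a = 0" for A and a :: "'n rvec"
    by (simp add: twist_def twist_form_def twist_diag_def Bmat_1 diag0)
  have "twist_diag A (mat 1) = 0" for A :: "'n zmat"
    by (simp add: twist_diag_def diagvec_def vec_eq_iff transpose_mat)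
  then have t2: "twist A (mat 1) a = 0" for A and a :: "'n rvec"
    by (simp add: twist_def twist_form_def Bmat_1)
  have key: "character (m_cocycle A B C) (rmat (A ** B ** C) *v a) + of_real_circle (twist (A ** B) C a)
        + of_real_circle (twist A B (rmat C *v a))
      = of_real_circle (twist A (B ** C) a) + zscale (isosign A) (of_real_circle (twist B C a))"
    if "A \<in> carrier Opm" "B \<in> carrier Opm" "C \<in> carrier Opm" for A B C :: "'n zmat" and a
    by (simp only: character_def m_cocycle_inner[OF that] zscale_of_real of_real_circle_add[symmetric]
        twist_cocycle[OF that(1,2)])
  show ?thesis
    unfolding k_cocycle_def
  proof (intro conjI ballI)
    fix A B C :: "'n zmat" assume G: "A \<in> carrier Opm" "B \<in> carrier Opm" "C \<in> carrier Opm"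
    show "vcomp strict_AUT_TD
       (vcomp strict_AUT_TD
         (strict_AUT_TD_pi1 (m_cocycle A B C) \<otimes>\<^bsub>Mor strict_AUT_TD\<^esub> idm strict_AUT_TD (std_obj (A \<otimes>\<^bsub>Opm\<^esub> B \<otimes>\<^bsub>Opm\<^esub> C)))
         (amult (std_obj (A \<otimes>\<^bsub>Opm\<^esub> B)) (std_obj C), \<lambda>a. of_real_circle (twist (A \<otimes>\<^bsub>Opm\<^esub> B) C a), std_obj (A \<otimes>\<^bsub>Opm\<^esub> B ** C)))
       ((amult (std_obj A) (std_obj B), \<lambda>a. of_real_circle (twist A B a), std_obj (A ** B)) \<otimes>\<^bsub>Mor strict_AUT_TD\<^esub> idm strict_AUT_TD (std_obj C))
      = vcomp strict_AUT_TD
       (amult (std_obj A) (std_obj (B \<otimes>\<^bsub>Opm\<^esub> C)), \<lambda>a. of_real_circle (twist A (B \<otimes>\<^bsub>Opm\<^esub> C) a), std_obj (A ** (B \<otimes>\<^bsub>Opm\<^esub> C)))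
       (idm strict_AUT_TD (std_obj A) \<otimes>\<^bsub>Mor strict_AUT_TD\<^esub>
         (amult (std_obj B) (std_obj C), \<lambda>a. of_real_circle (twist B C a), std_obj (B ** C)))"
      using G by (simp add: pi1_eq amult_one key amult_assoc is_aobj_std_obj matrix_mul_assoc)
  qed (simp_all add: is_aobj_std_obj S1 amult_one t1 t2 is_amor_twist)
qed

theorem proposition5p4p1:
  shows "\<exists>m :: ('n::{finite,linorder}) zmat \<Rightarrow> 'n zmat \<Rightarrow> 'n zmat \<Rightarrow> 'n zvec.
    (\<forall>A\<in>carrier Opm. \<forall>B\<in>carrier Opm. \<forall>C\<in>carrier Opm. rvec (m A B C) = m_expr A B C) \<and>
    m \<in> cocycles3 Opm Opm_act \<and>
    identified_two_group strict_AUT_TD Opm (Opm_act :: 'n zmat \<Rightarrow> 'n zvec \<Rightarrow> 'n zvec) fst strict_AUT_TD_pi1 \<and>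
    H3_class Opm Opm_act m =
      k_invariant strict_AUT_TD Opm Opm_act fst strict_AUT_TD_pi1"
proof (intro exI conjI ballI)
  show "rvec (m_cocycle A B C) = m_expr A B C"
    if "A \<in> carrier Opm" "B \<in> carrier Opm" "C \<in> carrier Opm" for A B C :: "'n zmat"
    using that by (rule rvec_m_cocycle)
  show "(m_cocycle :: 'n zmat \<Rightarrow> _) \<in> cocycles3 Opm Opm_act"
    by (rule k_cocycle_in_cocycles3[OF k_cocycle_m_cocycle])
  show "identified_two_group strict_AUT_TD Opm (Opm_act :: 'n zmat \<Rightarrow> 'n zvec \<Rightarrow> 'n zvec) fst strict_AUT_TD_pi1"
    by (rule identified_two_group_AUT_TD)
  show "H3_class Opm Opm_act (m_cocycle :: 'n zmat \<Rightarrow> _) =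
      k_invariant strict_AUT_TD Opm Opm_act fst strict_AUT_TD_pi1"
    by (rule k_invariant_eq_H3_class[OF k_cocycle_m_cocycle, symmetric])
qed

end
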